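(* Let $n>3$ be an integer. Suppose that for every Class-I code $C$ of blocklength $n$ with $|1|_C\ge 3$, and for every column position $t$ of $C$ whose column has type $1$, the code $C'$ obtained from $C$ by replacing the column at position $t$ with the column of type $s(C)$ satisfies $\lambda_{C'}(\varepsilon)\ge\lambda_C(\varepsilon)$ for all $0<\varepsilon<1/2$. Then for every code $C$ of blocklength $n$ that is not equivalent to any linear code, there exists a code $D$ of blocklength $n$ with $\lambda_D(\varepsilon)>\lambda_C(\varepsilon)$ for all $0<\varepsilon<1/2$.
   Context: A code of blocklength $n$ (an "$(n,4)$ code") is here an arbitrary $4\times n$ binary matrix $C$ (repeated rows are allowed), with rows (codewords) $r_0,r_1,r_2,r_3\in\{0,1\}^n$ and $n$ columns in $\{0,1\}^4$. For $y\in\{0,1\}^n$ let $d_C(y)=\min_{0\le j\le 3} d_H(r_j,y)$, where $d_H$ is Hamming distance, and $$\lambda_C(\varepsilon)=\tfrac14\sum_{y\in\{0,1\}^n}(1-\varepsilon)^{n-d_C(y)}\varepsilon^{d_C(y)}.$$ Two codes are equivalent if one is obtained from the other by a permutation of the rows, a permutation of the columns, and flipping all four bits in some subset of the columns. The type of a column $(b_0,b_1,b_2,b_3)^T$ ($b_j$ the entry in row $j$) is the integer $8b_0+4b_1+2b_2+b_3\in\{0,\dots,15\}$. $|i|_C$ denotes the number of columns of $C$ of type $i$. Linear: $C$ is linear if every column has type in $\{0,3,5,6\}$ and at least two of $|3|_C,|5|_C,|6|_C$ are positive. Class-I: $|1|_C+|3|_C+|5|_C+|6|_C=n$, $|1|_C$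 is odd, and $|3|_C,|5|_C,|6|_C$ are all even or all odd. For a code $C$, $s(C)\in\{3,5,6\}$ is the type $s$ minimizing $|s|_C$ over $s\in\{3,5,6\}$, ties being broken in favor of the earlier element in the order $3,5,6$. *)

theory Defs
  imports "Jordan_Normal_Form.Matrix" "HOL-Combinatorics.Permutations"
begin

text \<open>
  Binary matrices and words are matrices and vectors over \<^typ>\<open>bool\<close>, with \<^const>\<open>True\<close> as the bit 1.
  Rows and columns are numbered from 0. No distinctness of the rows is required.
\<close>

abbreviation codes :: "nat \<Rightarrow> bool mat set" where
  "codes n \<equiv> carrier_mat 4 n"

definition hamming_dist :: "bool vec \<Rightarrow> bool vec \<Rightarrow> nat" where
  "hamming_dist x y = card {t. t < dim_vec x \<and> x $ t \<noteq> y $ t}"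

definition code_dist :: "bool mat \<Rightarrow> bool vec \<Rightarrow> nat" where
  "code_dist C y = Min ((\<lambda>j. hamming_dist (row C j) y) ` {0..3})"

definition success_prob :: "bool mat \<Rightarrow> real \<Rightarrow> real" where
  "success_prob C \<epsilon> =
     1 / 4 * (\<Sum>y\<in>carrier_vec (dim_col C).
        (1 - \<epsilon>) ^ (dim_col C - code_dist C y) * \<epsilon> ^ code_dist C y)"

text \<open>The set \<open>F\<close> consists of the columns in which all four bits are flipped.\<close>

definition equivalent_codes :: "nat \<Rightarrow> bool mat \<Rightarrow> bool mat \<Rightarrow> bool" where
  "equivalent_codes n C D \<longleftrightarrow>
     C \<in> codes n \<and> D \<in> codes n \<and>
     (\<exists>\<pi> \<sigma> F. \<pi> permutes {..<4} \<and> \<sigma> permutes {..<n} \<and> F \<subseteq> {..<n} \<and>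
        (\<forall>j<4. \<forall>t<n. D $$ (j, t) =
           (if t \<in> F then \<not> C $$ (\<pi> j, \<sigma> t) else C $$ (\<pi> j, \<sigma> t))))"

definition col_type :: "bool mat \<Rightarrow> nat \<Rightarrow> nat" where
  "col_type C t = 8 * of_bool (C $$ (0, t)) + 4 * of_bool (C $$ (1, t))
     + 2 * of_bool (C $$ (2, t)) + of_bool (C $$ (3, t))"

definition type_count :: "bool mat \<Rightarrow> nat \<Rightarrow> nat" where
  "type_count C i = card {t. t < dim_col C \<and> col_type C t = i}"

definition linear_code :: "nat \<Rightarrow> bool mat \<Rightarrow> bool" where
  "linear_code n C \<longleftrightarrow>
     C \<in> codes n \<and> (\<forall>t<n. col_type C t \<in> {0, 3, 5, 6}) \<and>
     card {i \<in> {3, 5, 6}. type_count C i > 0} \<ge> 2"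

definition class_I :: "nat \<Rightarrow> bool mat \<Rightarrow> bool" where
  "class_I n C \<longleftrightarrow>
     C \<in> codes n \<and>
     type_count C 1 + type_count C 3 + type_count C 5 + type_count C 6 = n \<and>
     odd (type_count C 1) \<and>
     ((\<forall>i\<in>{3, 5, 6}. even (type_count C i)) \<or> (\<forall>i\<in>{3, 5, 6}. odd (type_count C i)))"

text \<open>\<^const>\<open>arg_min_list\<close> resolves ties in favour of the earlier list element.\<close>

definition min_type :: "bool mat \<Rightarrow> nat" where
  "min_type C = arg_min_list (type_count C) [3, 5, 6]"

text \<open>Row 0 holds the most significant bit of the type, hence \<open>3 - j\<close>.\<close>

definition replace_col :: "bool mat \<Rightarrow> nat \<Rightarrow> nat \<Rightarrow> bool mat" where
  "replace_col C t s =
     mat 4 (dim_col C) (\<lambda>(j, u). if u = t then bit s (3 - j) else C $$ (j, u))"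

lemma col_type_replace_col:
  assumes "t < dim_col C" "u < dim_col C" "s < 16"
  shows "col_type (replace_col C t s) u = (if u = t then s else col_type C u)"
proof (cases "u = t")
  case True
  have "s \<in> {0, 1, 2, 3, 4, 5, 6, 7, 8, 9, 10, 11, 12, 13, 14, 15}"
    using assms(3) by (simp, presburger)
  then show ?thesis
    using True assms by (auto simp: col_type_def replace_col_def bit_iff_odd)
qed (use assms in \<open>simp add: col_type_def replace_col_def\<close>)

end

theory Submission imports Defs begin

text \<open>
Put \<open>q = \<epsilon> / (1 - \<epsilon>)\<close>. Up to the factor \<open>(1 - \<epsilon>)^n / 4\<close> the success probability is
\<open>\<Sum>\<^sub>y q^m(y)\<close>, where \<open>m(y)\<close> is the distance from the word \<open>y\<close> to its nearest rows. Delete column \<open>t\<close>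
and let \<open>M(y)\<close> be the set of rows nearest to a word \<open>y\<close> of the remaining code. Then a column with bits \<open>b\<close>
in position \<open>t\<close> turns the term of \<open>y\<close> into \<open>q^m(y) (1 + q)\<close> if \<open>b\<close> is constant on \<open>M(y)\<close>, and into
\<open>2 q^m(y)\<close>, which is larger, if \<open>b\<close> splits \<open>M(y)\<close>. Choosing a good column therefore means splitting the tie
sets \<open>M(y)\<close> of large weight (\<open>weight_sum_column_diff\<close>).

Two rows can tie only if their distance is even, and "even distance" is an equivalence relation on the
rows. Call a column lone if it separates one row from the other three; complementing a column changes
nothing, so every other column is constant or pairs the rows off two against two. The parity of the number
\<open>k\<close> of lone columns decides between the splits 4 and 2 + 2 of the rows into parity classes (\<open>k\<close> even), and
the split 3 + 1 (\<open>k\<close> odd).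

Every code with \<open>k > 0\<close> is strictly beaten, by induction on \<open>k\<close> (\<open>lone_code_better\<close>). If all distances
are even, a lone column separating row \<open>i\<close> splits no tie at all once it has been deleted, for \<open>i\<close> is then
alone in its parity class; some ties exist (\<open>odd_disagreements_tie\<close>), so another column is strictly
better. If row \<open>i\<close> has even distance to another row \<open>l\<close>, replacing the lone column by one that pairs \<open>i\<close>
with \<open>l\<close> loses nothing (\<open>pair_column_weakly_better\<close>) and lowers \<open>k\<close>. The only codes that escape this have
odd \<open>k\<close>, and all their lone columns separate the row that is alone in its parity class. If such a code has a
constant column, that column can be improved strictly; otherwise it is equivalent to a Class-I code, and for
\<open>k \<ge> 3\<close> the hypothesis of the theorem lowers \<open>k\<close> (\<open>class_I_replacement\<close>).

What remains is \<open>k = 1\<close> and \<open>k = 0\<close>. For \<open>k = 1\<close> the deletion of the lone column leaves columns that pair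
the rows off in the three possible ways, and the distances of a word depend only on three numbers, one per
pairing. If the lone column separates the row alone in its class, replace it by a column of the rarest
pairing: the ties that are lost weigh no more than those gained, by an inequality between products of
binomial coefficients (\<open>binomial_shift_le\<close>, \<open>pair_tie_weight_mono\<close>), and the gain has a further positive
term. Otherwise one or two replacements suffice, the second being possible because \<open>n > 3\<close>
(\<open>single_lone_column_better\<close>). For \<open>k = 0\<close>
a code that is not equivalent to a linear one uses at most one pairing, so its rows coincide in pairs, and a
column separating equal rows splits every tie (\<open>two_row_code_better\<close>).
\<close>

section \<open>Distances and the effect of a single column\<close>

text \<open>
Words are the sets of positions where their bit is 1, and columns are indexed by an arbitrary finite set
\<open>T\<close>, so that a column can be deleted without renumbering the others.
\<close>

definition row_dist :: "nat set \<Rightarrow> (nat \<Rightarrow> nat \<Rightarrow> bool) \<Rightarrow> nat set \<Rightarrow> nat \<Rightarrow> nat" where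
  "row_dist T c Y j = card {t \<in> T. c t j \<noteq> (t \<in> Y)}"

definition min_dist :: "nat set \<Rightarrow> (nat \<Rightarrow> nat \<Rightarrow> bool) \<Rightarrow> nat set \<Rightarrow> nat" where
  "min_dist T c Y = Min (row_dist T c Y ` {..<4})"

definition nearest :: "nat set \<Rightarrow> (nat \<Rightarrow> nat \<Rightarrow> bool) \<Rightarrow> nat set \<Rightarrow> nat set" where
  "nearest T c Y = {j. j < 4 \<and> row_dist T c Y j = min_dist T c Y}"

text \<open>
With \<open>q = \<epsilon> / (1 - \<epsilon>)\<close> this is the success probability without the factor \<open>(1 - \<epsilon>)^n / 4\<close>, which
is the same for all codes of that blocklength.
\<close>

definition weight_sum :: "nat set \<Rightarrow> (nat \<Rightarrow> nat \<Rightarrow> bool) \<Rightarrow> real \<Rightarrow> real" where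
  "weight_sum T c q = (\<Sum>Y\<in>Pow T. q ^ min_dist T c Y)"

definition splits :: "(nat \<Rightarrow> bool) \<Rightarrow> nat set \<Rightarrow> bool" where
  "splits b M \<longleftrightarrow> (\<exists>i\<in>M. \<exists>j\<in>M. b i \<noteq> b j)"

lemma card_filter_insert:
  assumes "finite T" "t \<notin> T"
  shows "card {s \<in> insert t T. P s} = card {s \<in> T. P s} + of_bool (P t)"
proof -
  have "{s \<in> insert t T. P s} = (if P t then insert t {s \<in> T. P s} else {s \<in> T. P s})"
    by auto
  then show ?thesis using assms by simp
qed

lemma row_dist_insert:
  assumes "finite T" "t \<notin> T"
  shows "row_dist (insert t T) c Y j = row_dist T c Y j + of_bool (c t j \<noteq> (t \<in> Y))"
  unfolding row_dist_def using assms by (rule card_filter_insert)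

lemma row_dist_cong:
  assumes "\<And>t. t \<in> T \<Longrightarrow> c t j = c' t j'" "\<And>t. t \<in> T \<Longrightarrow> t \<in> Y \<longleftrightarrow> t \<in> Y'"
  shows "row_dist T c Y j = row_dist T c' Y' j'"
  unfolding row_dist_def using assms by (metis (mono_tags, lifting) Collect_cong)

lemma nearest_iff: "j \<in> nearest T c Y \<longleftrightarrow> j < 4 \<and> (\<forall>k<4. row_dist T c Y j \<le> row_dist T c Y k)"
proof -
  have "row_dist T c Y j = Min (row_dist T c Y ` {..<4}) \<longleftrightarrow> (\<forall>k<4. row_dist T c Y j \<le> row_dist T c Y k)"
    if "j < 4"
  proof -
    have "row_dist T c Y ` {..<4} \<noteq> {}" using that by auto
    then show ?thesis using that eq_Min_iff[of "row_dist T c Y ` {..<4}" "row_dist T c Y j"] by auto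
  qed
  then show ?thesis unfolding nearest_def min_dist_def by auto
qed

lemma nearest_nonempty: "nearest T c Y \<noteq> {}"
proof -
  have "min_dist T c Y \<in> row_dist T c Y ` {..<4}"
    unfolding min_dist_def by (intro Min_in) (auto simp: lessThan_empty_iff)
  then show ?thesis unfolding nearest_def by auto
qed

lemma min_dist_eqI:
  assumes "j < 4" "row_dist T c Y j = m" "\<And>k. k < 4 \<Longrightarrow> m \<le> row_dist T c Y k"
  shows "min_dist T c Y = m"
  unfolding min_dist_def using assms by (intro Min_eqI) auto

lemma min_dist_le: "k < 4 \<Longrightarrow> min_dist T c Y \<le> row_dist T c Y k"
  unfolding min_dist_def by simp

lemma min_dist_insert:
  assumes "finite T" "t \<notin> T"
  shows "min_dist (insert t T) c Y
    = min_dist T c Y + of_bool (\<forall>j\<in>nearest T c Y. c t j \<noteq> (t \<in> Y))"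
proof (cases "\<forall>j\<in>nearest T c Y. c t j \<noteq> (t \<in> Y)")
  case True
  obtain j where j: "j \<in> nearest T c Y" using nearest_nonempty by blast
  show ?thesis
  proof (rule min_dist_eqI[of j])
    show "min_dist T c Y + of_bool (\<forall>j\<in>nearest T c Y. c t j \<noteq> (t \<in> Y))
        \<le> row_dist (insert t T) c Y k" if k: "k < 4" for k
    proof (cases "k \<in> nearest T c Y")
      case False
      then have "min_dist T c Y < row_dist T c Y k"
        using min_dist_le[OF k, of T c Y] k unfolding nearest_def by auto
      then show ?thesis using assms by (simp add: row_dist_insert)
    qed (use True assms in \<open>auto simp: row_dist_insert nearest_def\<close>)
  qed (use j True assms in \<open>auto simp: row_dist_insert nearest_def\<close>)
next
  case False
  then obtain j where j: "j \<in> nearest T c Y" "c t j = (t \<in> Y)" by blast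
  have "min_dist (insert t T) c Y = min_dist T c Y"
  proof (rule min_dist_eqI[of j])
    show "min_dist T c Y \<le> row_dist (insert t T) c Y k" if "k < 4" for k
      using min_dist_le[OF that, of T c Y] assms by (simp add: row_dist_insert)
  qed (use j assms in \<open>auto simp: row_dist_insert nearest_def\<close>)
  then show ?thesis using False by simp
qed

lemma sum_Pow_insert:
  fixes f :: "'a set \<Rightarrow> 'b::comm_monoid_add"
  assumes "finite T" "t \<notin> T"
  shows "(\<Sum>Y\<in>Pow (insert t T). f Y) = (\<Sum>Y\<in>Pow T. f Y + f (insert t Y))"
proof -
  have "inj_on (insert t) (Pow T)" using assms(2)
    by (auto simp: inj_on_def)
  moreover have "Pow T \<inter> insert t ` Pow T = {}" using assms(2) by auto
  ultimately show ?thesis using assms(1)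
    by (simp add: Pow_insert sum.union_disjoint sum.reindex sum.distrib)
qed

lemma min_dist_cong:
  assumes "\<And>t j. t \<in> T \<Longrightarrow> j < 4 \<Longrightarrow> c t j = c' t j" "\<And>t. t \<in> T \<Longrightarrow> t \<in> Y \<longleftrightarrow> t \<in> Y'"
  shows "min_dist T c Y = min_dist T c' Y'"
proof -
  have "row_dist T c Y ` {..<4} = row_dist T c' Y' ` {..<4}"
    by (rule image_cong) (auto intro!: row_dist_cong assms)
  then show ?thesis unfolding min_dist_def by simp
qed

lemma nearest_cong:
  assumes "\<And>t j. t \<in> T \<Longrightarrow> j < 4 \<Longrightarrow> c t j = c' t j" "\<And>t. t \<in> T \<Longrightarrow> t \<in> Y \<longleftrightarrow> t \<in> Y'"
  shows "nearest T c Y = nearest T c' Y'"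
proof -
  have "row_dist T c Y j = row_dist T c' Y' j" if "j < 4" for j
    using assms that by (intro row_dist_cong) auto
  then show ?thesis unfolding nearest_def using min_dist_cong[OF assms] by auto
qed

text \<open>
A word \<open>Y\<close> has two extensions to the new position. If the new bits are constant on the nearest rows, one
extension keeps the minimal distance \<open>m\<close> and the other has \<open>m + 1\<close>; if the bits split the nearest rows,
both keep \<open>m\<close>. This gives \<open>q^m + q^(m + 1)\<close> and \<open>2 q^m\<close>.
\<close>

lemma weight_sum_insert:
  assumes "finite T" "t \<notin> T"
  shows "weight_sum (insert t T) c q =
    (\<Sum>Y\<in>Pow T. q ^ min_dist T c Y * (1 + q + (1 - q) * of_bool (splits (c t) (nearest T c Y))))"
  unfolding weight_sum_def sum_Pow_insert[OF assms]
proof (rule sum.cong[OF refl])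
  fix Y assume "Y \<in> Pow T"
  then have t: "t \<notin> Y" using assms by auto
  have *: "min_dist T c (insert t Y) = min_dist T c Y" "nearest T c (insert t Y) = nearest T c Y"
    using assms by (auto intro!: min_dist_cong nearest_cong)
  obtain j where j: "j \<in> nearest T c Y" using nearest_nonempty by blast
  consider "\<forall>j\<in>nearest T c Y. c t j" | "\<forall>j\<in>nearest T c Y. \<not> c t j" | "splits (c t) (nearest T c Y)"
    unfolding splits_def using j by metis
  then show "q ^ min_dist (insert t T) c Y + q ^ min_dist (insert t T) c (insert t Y)
      = q ^ min_dist T c Y * (1 + q + (1 - q) * of_bool (splits (c t) (nearest T c Y)))"
  proof cases
    case 1
    then have "\<not> (\<forall>j\<in>nearest T c Y. \<not> c t j)" "\<not> splits (c t) (nearest T c Y)"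
      using j by (auto simp: splits_def)
    with 1 t show ?thesis by (simp add: min_dist_insert[OF assms] * algebra_simps)
  next
    case 2
    then have "\<not> (\<forall>j\<in>nearest T c Y. c t j)" "\<not> splits (c t) (nearest T c Y)"
      using j by (auto simp: splits_def)
    with 2 t show ?thesis by (simp add: min_dist_insert[OF assms] * algebra_simps)
  next
    case 3
    then have "\<not> (\<forall>j\<in>nearest T c Y. c t j)" "\<not> (\<forall>j\<in>nearest T c Y. \<not> c t j)"
      by (auto simp: splits_def)
    with 3 t show ?thesis by (simp add: min_dist_insert[OF assms] * algebra_simps del: not_all ball_simps)
  qed
qed

definition weakly_better :: "nat set \<Rightarrow> (nat \<Rightarrow> nat \<Rightarrow> bool) \<Rightarrow> (nat \<Rightarrow> nat \<Rightarrow> bool) \<Rightarrow> bool" where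
  "weakly_better T c' c \<longleftrightarrow> (\<forall>q. 0 < q \<and> q < 1 \<longrightarrow> weight_sum T c q \<le> weight_sum T c' q)"

definition better :: "nat set \<Rightarrow> (nat \<Rightarrow> nat \<Rightarrow> bool) \<Rightarrow> (nat \<Rightarrow> nat \<Rightarrow> bool) \<Rightarrow> bool" where
  "better T c' c \<longleftrightarrow> (\<forall>q. 0 < q \<and> q < 1 \<longrightarrow> weight_sum T c q < weight_sum T c' q)"

lemma better_trans: "better T c'' c' \<Longrightarrow> weakly_better T c' c \<Longrightarrow> better T c'' c"
  unfolding better_def weakly_better_def by (meson order_le_less_trans)

lemma weight_sum_column_diff:
  assumes "finite T" "t \<in> T"
  shows "weight_sum T (c(t := b)) q - weight_sum T c q =
    (1 - q) * (\<Sum>Y\<in>Pow (T - {t}). q ^ min_dist (T - {t}) c Y *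
      (of_bool (splits b (nearest (T - {t}) c Y)) - of_bool (splits (c t) (nearest (T - {t}) c Y))))"
proof -
  have *: "min_dist (T - {t}) (c(t := b)) Y = min_dist (T - {t}) c Y"
          "nearest (T - {t}) (c(t := b)) Y = nearest (T - {t}) c Y" for Y
    by (auto intro!: min_dist_cong nearest_cong)
  have "weight_sum T c' q = (\<Sum>Y\<in>Pow (T - {t}). q ^ min_dist (T - {t}) c' Y *
      (1 + q + (1 - q) * of_bool (splits (c' t) (nearest (T - {t}) c' Y))))" for c'
    using weight_sum_insert[of "T - {t}" t c' q] assms by (simp add: insert_absorb)
  then show ?thesis
    by (simp only: * fun_upd_same sum_subtractf[symmetric] sum_distrib_left)
       (rule sum.cong[OF refl], simp add: algebra_simps)
qed

text \<open>
In most replacements the new column splits every tie set that the old one splits, so that the comparison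
holds term by term, for all \<open>q\<close> at once.
\<close>

lemma column_weakly_better:
  assumes "finite T" "t \<in> T"
    and "\<And>Y. splits (c t) (nearest (T - {t}) c Y) \<Longrightarrow> splits b (nearest (T - {t}) c Y)"
  shows "weakly_better T (c(t := b)) c"
  unfolding weakly_better_def
proof safe
  fix q :: real assume q: "0 < q" "q < 1"
  have "0 \<le> (\<Sum>Y\<in>Pow (T - {t}). q ^ min_dist (T - {t}) c Y *
      (of_bool (splits b (nearest (T - {t}) c Y)) - of_bool (splits (c t) (nearest (T - {t}) c Y))))"
    using q assms(3) by (intro sum_nonneg) auto
  then have "0 \<le> weight_sum T (c(t := b)) q - weight_sum T c q"
    using weight_sum_column_diff[OF assms(1,2), of c b q] q by simp
  then show "weight_sum T c q \<le> weight_sum T (c(t := b)) q" by simp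
qed

lemma column_better:
  assumes "finite T" "t \<in> T"
    and "\<And>Y. splits (c t) (nearest (T - {t}) c Y) \<Longrightarrow> splits b (nearest (T - {t}) c Y)"
    and Y0: "Y0 \<subseteq> T - {t}" "splits b (nearest (T - {t}) c Y0)" "\<not> splits (c t) (nearest (T - {t}) c Y0)"
  shows "better T (c(t := b)) c"
  unfolding better_def
proof safe
  fix q :: real assume q: "0 < q" "q < 1"
  have "0 < (\<Sum>Y\<in>Pow (T - {t}). q ^ min_dist (T - {t}) c Y *
      (of_bool (splits b (nearest (T - {t}) c Y)) - of_bool (splits (c t) (nearest (T - {t}) c Y))))"
    using q assms by (intro sum_pos2[of _ Y0]) auto
  then have "0 < weight_sum T (c(t := b)) q - weight_sum T c q"
    using weight_sum_column_diff[OF assms(1,2), of c b q] q by simp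
  then show "weight_sum T c q < weight_sum T (c(t := b)) q" by simp
qed

section \<open>Parities of the distances between rows\<close>

definition disagreement :: "nat set \<Rightarrow> (nat \<Rightarrow> nat \<Rightarrow> bool) \<Rightarrow> nat \<Rightarrow> nat \<Rightarrow> nat" where
  "disagreement T c i j = card {t \<in> T. c t i \<noteq> c t j}"

lemma disagreement_insert:
  assumes "finite T" "t \<notin> T"
  shows "disagreement (insert t T) c i j = disagreement T c i j + of_bool (c t i \<noteq> c t j)"
  unfolding disagreement_def using assms by (rule card_filter_insert)

lemma disagreement_remove:
  assumes "finite T" "t \<in> T"
  shows "disagreement T c i j = disagreement (T - {t}) c i j + of_bool (c t i \<noteq> c t j)"
  using disagreement_insert[of "T - {t}" t c i j] assms by (simp add: insert_absorb)

lemma disagreement_sym: "disagreement T c i j = disagreement T c j i"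
  unfolding disagreement_def by (metis (mono_tags, lifting))

text \<open>
Modulo 2 the distance between two rows is the sum of their distances to any word. So nearest rows, being
equally far from a word, lie in the same parity class.
\<close>

lemma even_row_dist_add:
  assumes "finite T"
  shows "even (row_dist T c Y i + row_dist T c Y j) \<longleftrightarrow> even (disagreement T c i j)"
  using assms
proof (induction T rule: finite_induct)
  case empty
  then show ?case by (simp add: row_dist_def disagreement_def)
next
  case (insert t T)
  then show ?case by (auto simp: row_dist_insert disagreement_insert)
qed

lemma disagreement_parity_trans:
  assumes "finite T"
  shows "even (disagreement T c i j + disagreement T c j k + disagreement T c i k)"
  using assms
proof (induction T rule: finite_induct)
  case empty
  then show ?case by (simp add: disagreement_def)
next
  case (insert t T)
  then show ?case by (auto simp: disagreement_insert)
qed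

lemma nearest_even_disagreement:
  assumes "finite T" "i \<in> nearest T c Y" "j \<in> nearest T c Y"
  shows "even (disagreement T c i j)"
  using even_row_dist_add[OF assms(1), of c Y i j] assms(2,3) by (simp add: nearest_def)

text \<open>
Up to complementation, a unit vector.
\<close>

definition isolates :: "(nat \<Rightarrow> bool) \<Rightarrow> nat \<Rightarrow> bool" where
  "isolates b l \<longleftrightarrow> l < 4 \<and> (\<forall>j<4. j \<noteq> l \<longrightarrow> b j \<noteq> b l)"

definition lone :: "(nat \<Rightarrow> bool) \<Rightarrow> bool" where
  "lone b \<longleftrightarrow> (\<exists>l. isolates b l)"

text \<open>
The arguments below are symmetric under permutations of the four rows; naming the rows by an arbitrary
enumeration avoids fixing their numbers.
\<close>

definition row_labels :: "nat \<Rightarrow> nat \<Rightarrow> nat \<Rightarrow> nat \<Rightarrow> bool" where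
  "row_labels i l p q \<longleftrightarrow> {i, l, p, q} = {..<4} \<and> distinct [i, l, p, q]"

definition pairs :: "(nat \<Rightarrow> bool) \<Rightarrow> nat \<Rightarrow> nat \<Rightarrow> nat \<Rightarrow> nat \<Rightarrow> bool" where
  "pairs b i l p q \<longleftrightarrow> b i = b l \<and> b p = b q \<and> b i \<noteq> b p"

lemma all_rows_labels: "row_labels i l p q \<Longrightarrow> (\<forall>j<4. P j) \<longleftrightarrow> P i \<and> P l \<and> P p \<and> P q"
proof -
  assume "row_labels i l p q"
  then have "{..<4} = {i, l, p, q}" by (simp add: row_labels_def)
  then have "(\<forall>j\<in>{..<4}. P j) \<longleftrightarrow> (\<forall>j\<in>{i, l, p, q}. P j)" by simp
  then show ?thesis by auto
qed

lemma row_labels_less: "row_labels i l p q \<Longrightarrow> i < 4 \<and> l < 4 \<and> p < 4 \<and> q < 4"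
  unfolding row_labels_def by auto

lemma row_labels_distinct:
  "row_labels i l p q \<Longrightarrow> i \<noteq> l \<and> i \<noteq> p \<and> i \<noteq> q \<and> l \<noteq> p \<and> l \<noteq> q \<and> p \<noteq> q"
  unfolding row_labels_def by auto

lemma row_labels_swap:
  assumes "row_labels i l p q"
  shows "row_labels l i p q" "row_labels i p l q" "row_labels i l q p"
  using assms unfolding row_labels_def by (auto simp: insert_commute)

lemma row_labels_rotate: "row_labels i l p q \<Longrightarrow> row_labels p q i l"
  unfolding row_labels_def by (auto simp: insert_commute)

lemma row_labels_exist:
  assumes "i < 4" "l < 4" "i \<noteq> l"
  obtains p q where "row_labels i l p q"
proof -
  have "card ({..<4} - {i, l}) = 2" using assms by (simp add: card_Diff_subset)
  then obtain p q where pq: "{..<4} - {i, l} = {p, q}" "p \<noteq> q" by (meson card_2_iff)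
  then have "p \<notin> {i, l}" "q \<notin> {i, l}" "{..<4} = {i, l, p, q}" using assms by auto
  then have "row_labels i l p q" using pq assms unfolding row_labels_def by auto
  then show ?thesis by (rule that)
qed

lemma isolates_less: "isolates b l \<Longrightarrow> l < 4"
  by (simp add: isolates_def)

lemma isolates_labels:
  "row_labels i l p q \<Longrightarrow> isolates b i \<longleftrightarrow> b l \<noteq> b i \<and> b p \<noteq> b i \<and> b q \<noteq> b i"
  unfolding isolates_def using row_labels_distinct row_labels_less by (subst all_rows_labels) auto

lemma lone_labels:
  assumes L: "row_labels i l p q"
  shows "lone b \<longleftrightarrow> isolates b i \<or> isolates b l \<or> isolates b p \<or> isolates b q"
proof -
  have "lone b \<longleftrightarrow> \<not> (\<forall>j<4. \<not> isolates b j)" unfolding lone_def using isolates_less by blast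
  then show ?thesis unfolding all_rows_labels[OF L] by simp
qed

lemma isolates_all_labels:
  assumes "row_labels i l p q"
  shows "isolates b i \<longleftrightarrow> b l \<noteq> b i \<and> b p \<noteq> b i \<and> b q \<noteq> b i"
        "isolates b l \<longleftrightarrow> b i \<noteq> b l \<and> b p \<noteq> b l \<and> b q \<noteq> b l"
        "isolates b p \<longleftrightarrow> b i \<noteq> b p \<and> b l \<noteq> b p \<and> b q \<noteq> b p"
        "isolates b q \<longleftrightarrow> b i \<noteq> b q \<and> b l \<noteq> b q \<and> b p \<noteq> b q"
  using isolates_labels[OF assms] isolates_labels[OF row_labels_swap(1)[OF assms]]
    isolates_labels[OF row_labels_swap(1)[OF row_labels_swap(2)[OF assms]]]
    isolates_labels[OF row_labels_swap(1)[OF row_labels_swap(2)[OF row_labels_swap(3)[OF assms]]]]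
  by auto

lemma lone_iff:
  assumes L: "row_labels i l p q"
  shows "lone b \<longleftrightarrow> (b i \<noteq> b l) \<noteq> (b p \<noteq> b q)"
  unfolding lone_labels[OF L] isolates_all_labels[OF L] by auto

text \<open>
A column that is constant or divides the rows two against two separates none or both of the pairs
\<open>i, l\<close> and \<open>p, q\<close>; a lone column separates exactly one of them.
\<close>

lemma even_disagreement_lone:
  assumes "finite T" and L: "row_labels i l p q"
  shows "even (disagreement T c i l + disagreement T c p q) \<longleftrightarrow> even (card {t \<in> T. lone (c t)})"
  using assms(1)
proof (induction T rule: finite_induct)
  case empty
  then show ?case by (simp add: disagreement_def)
next
  case (insert t T)
  have "lone (c t) \<longleftrightarrow> (c t i \<noteq> c t l) \<noteq> (c t p \<noteq> c t q)" by (rule lone_iff[OF L])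
  with insert show ?case
    unfolding card_filter_insert[OF insert.hyps] disagreement_insert[OF insert.hyps] by auto
qed

lemma splitsI: "i \<in> M \<Longrightarrow> j \<in> M \<Longrightarrow> b i \<noteq> b j \<Longrightarrow> splits b M"
  unfolding splits_def by blast

section \<open>Words that are equidistant from several nearest rows\<close>

lemma row_dist_remove:
  assumes "finite T" "t \<in> T"
  shows "row_dist T c Y j = row_dist (T - {t}) c Y j + of_bool (c t j \<noteq> (t \<in> Y))"
  using row_dist_insert[of "T - {t}" t c Y j] assms by (simp add: insert_absorb)

lemma row_dist_flip_one:
  assumes "finite T" "t \<in> T" "\<And>s. s \<noteq> t \<Longrightarrow> s \<in> Y \<longleftrightarrow> s \<in> Y'"
  shows "row_dist T c Y' j \<le> row_dist T c Y j + 1" "row_dist T c Y j \<le> row_dist T c Y' j + 1"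
proof -
  have "row_dist (T - {t}) c Y j = row_dist (T - {t}) c Y' j"
    using assms(3) by (intro row_dist_cong) auto
  then show "row_dist T c Y' j \<le> row_dist T c Y j + 1" "row_dist T c Y j \<le> row_dist T c Y' j + 1"
    using row_dist_remove[OF assms(1,2), of c _ j] by auto
qed

text \<open>
A discrete intermediate value argument. Start at the complement of row \<open>i\<close> and walk to another row \<open>r\<close>.
Each step of a shortest walk moves towards \<open>i\<close> as well as towards \<open>r\<close>, so \<open>i\<close> never becomes nearest. The
other three rows lie in one parity class; hence different distances to them differ by at least 2, while a
step changes each of them by 1. So if no word had two nearest rows, the nearest row could not change, and
\<open>r\<close> would be the nearest row of the starting word, for all three choices of \<open>r\<close>.
\<close>

lemma odd_disagreements_tie:
  assumes fin: "finite T" and L: "row_labels i l p q"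
    and odd: "odd (disagreement T c i l)" "odd (disagreement T c i p)" "odd (disagreement T c i q)"
  obtains Y r s where "Y \<subseteq> T" "r \<in> nearest T c Y" "s \<in> nearest T c Y" "r \<noteq> s"
proof (rule ccontr)
  assume "\<not> thesis"
  then have unique: "r = s" if "Y \<subseteq> T" "r \<in> nearest T c Y" "s \<in> nearest T c Y" for Y r s
    using that \<open>\<And>Y r s. Y \<subseteq> T \<Longrightarrow> r \<in> nearest T c Y \<Longrightarrow> s \<in> nearest T c Y \<Longrightarrow> r \<noteq> s \<Longrightarrow> thesis\<close> by blast
  \<comment> \<open>The complement of row \<open>i\<close>, altered on \<open>A\<close>; the walk to row \<open>r\<close> lets \<open>A\<close> grow from the empty set
      to the set of positions where \<open>i\<close> and \<open>r\<close> agree.\<close>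
  define Y where "Y A = {t \<in> T. (\<not> c t i) \<noteq> (t \<in> A)}" for A
  have sub: "Y A \<subseteq> T" for A by (auto simp: Y_def)
  have "\<forall>j<4. j \<noteq> i \<longrightarrow> odd (disagreement T c i j)"
    unfolding all_rows_labels[OF L] using odd by simp
  then have odd': "odd (disagreement T c i j)" if "j < 4" "j \<noteq> i" for j using that by blast
  have reach: "r \<in> nearest T c (Y {})" if r: "r < 4" "r \<noteq> i" for r
  proof -
    define E where "E = {t \<in> T. c t i = c t r}"
    have not_i: "i \<notin> nearest T c (Y A)" if "A \<subseteq> E" for A
    proof -
      have "row_dist T c (Y A) i = card (T - A)"
        unfolding row_dist_def Y_def by (rule arg_cong[where f = card]) auto
      also have "T - A = (E - A) \<union> {t \<in> T. c t i \<noteq> c t r}"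
        using that by (auto simp: E_def)
      also have "card \<dots> = card (E - A) + disagreement T c i r"
        unfolding disagreement_def using fin by (intro card_Un_disjoint) (auto simp: E_def)
      also have "card (E - A) = row_dist T c (Y A) r"
        unfolding row_dist_def Y_def by (rule arg_cong[where f = card]) (use that in \<open>auto simp: E_def\<close>)
      finally have "row_dist T c (Y A) r < row_dist T c (Y A) i"
        using odd'[OF r] by (simp add: odd_pos)
      then show ?thesis using r(1) by (auto simp: nearest_iff not_le)
    qed
    have finE: "finite E" using fin by (simp add: E_def)
    have const: "nearest T c (Y A) = nearest T c (Y {})" if "A \<subseteq> E" for A
      using finite_subset[OF that finE] that
    proof (induction A rule: finite_induct)
      case (insert t A)
      have t: "t \<in> T" "A \<subseteq> E" using insert.prems by (auto simp: E_def)
      obtain r s where rs: "r \<in> nearest T c (Y A)" "s \<in> nearest T c (Y (insert t A))"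
        using nearest_nonempty by blast
      have lt: "r < 4" "s < 4" "r \<noteq> i" "s \<noteq> i"
        using rs not_i t(2) not_i[OF insert.prems] by (auto simp: nearest_iff)
      have "r = s"
      proof (rule ccontr)
        assume "r \<noteq> s"
        have "even (disagreement T c r s)"
          using disagreement_parity_trans[OF fin, of c i r s] odd'[OF lt(1,3)] odd'[OF lt(2,4)]
          by simp
        then have even: "even (row_dist T c (Y A) r + row_dist T c (Y A) s)"
          using even_row_dist_add[OF fin] by blast
        have "s \<notin> nearest T c (Y A)" "r \<notin> nearest T c (Y (insert t A))"
          using unique[OF sub] rs \<open>r \<noteq> s\<close> by blast+
        then have "row_dist T c (Y A) r < row_dist T c (Y A) s"
          "row_dist T c (Y (insert t A)) s < row_dist T c (Y (insert t A)) r"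
          using rs lt min_dist_le[OF lt(2), of T c "Y A"] min_dist_le[OF lt(1), of T c "Y (insert t A)"]
          by (simp_all add: nearest_def)
        moreover have "row_dist T c (Y (insert t A)) r \<le> row_dist T c (Y A) r + 1"
          "row_dist T c (Y A) s \<le> row_dist T c (Y (insert t A)) s + 1"
          by (rule row_dist_flip_one[OF fin t(1)]; force simp: Y_def)+
        ultimately have "row_dist T c (Y A) s = row_dist T c (Y A) r + 1" by linarith
        then show False using even by simp
      qed
      moreover have "nearest T c (Y A) = {r}" "nearest T c (Y (insert t A)) = {s}"
        using unique[OF sub] rs by blast+
      ultimately show ?case using insert.IH[OF t(2)] by simp
    qed simp
    have "row_dist T c (Y E) r = 0"
    proof -
      have "{t \<in> T. c t r \<noteq> (t \<in> Y E)} = {}" by (auto simp: Y_def E_def)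
      then show ?thesis by (simp only: row_dist_def card.empty)
    qed
    then have "r \<in> nearest T c (Y E)" using r by (simp add: nearest_iff)
    then show ?thesis using const[of E] by simp
  qed
  have "l = p"
    by (rule unique[OF sub]; rule reach) (use row_labels_less[OF L] row_labels_distinct[OF L] in auto)
  then show False using row_labels_distinct[OF L] by simp
qed

text \<open>
The tie sets avoid row \<open>i\<close> or consist of it alone, so a column that is constant on the other three rows
splits none of them. This covers both a column separating \<open>i\<close> and a constant column.
\<close>

lemma odd_row_column_better:
  assumes fin: "finite T" and t: "t \<in> T" and L: "row_labels i l p q"
    and odd: "odd (disagreement (T - {t}) c i l)" "odd (disagreement (T - {t}) c i p)"
      "odd (disagreement (T - {t}) c i q)"
    and eq: "c t l = c t p" "c t p = c t q"
  obtains b where "better T (c(t := b)) c"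
proof -
  have fin': "finite (T - {t})" using fin by simp
  obtain Y r s where Y: "Y \<subseteq> T - {t}" "r \<in> nearest (T - {t}) c Y" "s \<in> nearest (T - {t}) c Y" "r \<noteq> s"
    using odd_disagreements_tie[OF fin' L odd] .
  have all: "\<forall>j<4. j \<noteq> i \<longrightarrow> odd (disagreement (T - {t}) c i j)" "\<forall>j<4. j \<noteq> i \<longrightarrow> c t j = c t l"
    unfolding all_rows_labels[OF L] using odd eq by simp_all
  have no_split: "\<not> splits (c t) (nearest (T - {t}) c Z)" for Z
  proof
    assume "splits (c t) (nearest (T - {t}) c Z)"
    then obtain x y where xy: "x \<in> nearest (T - {t}) c Z" "y \<in> nearest (T - {t}) c Z" "c t x \<noteq> c t y"
      by (auto simp: splits_def)
    then have "x < 4" "y < 4" "x \<noteq> y" by (auto simp: nearest_iff)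
    moreover have "even (disagreement (T - {t}) c x y)" "even (disagreement (T - {t}) c y x)"
      using nearest_even_disagreement[OF fin'] xy by blast+
    ultimately have "x \<noteq> i" "y \<noteq> i" using all(1) by blast+
    then show False using all(2) xy(3) \<open>x < 4\<close> \<open>y < 4\<close> by simp
  qed
  have "better T (c(t := (\<lambda>j. j = r))) c"
  proof (rule column_better[OF fin t _ Y(1)])
    show "splits (\<lambda>j. j = r) (nearest (T - {t}) c Y)"
      by (rule splitsI[OF Y(2,3)]) (use Y(4) in auto)
  qed (simp_all add: no_split)
  then show ?thesis by (rule that)
qed

text \<open>
Deleting the lone column makes the distance between \<open>i\<close> and \<open>l\<close> odd. Every tie set that the lone column
splits contains \<open>i\<close> and some other row, which therefore is not \<open>l\<close> and is separated from \<open>i\<close> by the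
pairing of \<open>i\<close> with \<open>l\<close>.
\<close>

lemma pair_column_splits:
  assumes fin: "finite T" and t: "t \<in> T" and iso: "isolates (c t) i"
    and even: "even (disagreement T c i l)" and l: "l < 4" "l \<noteq> i"
    and split: "splits (c t) (nearest (T - {t}) c Y)"
  shows "splits (\<lambda>j. j = i \<or> j = l) (nearest (T - {t}) c Y)"
proof -
  obtain x y where xy: "x \<in> nearest (T - {t}) c Y" "y \<in> nearest (T - {t}) c Y" "c t x \<noteq> c t y"
    using split by (auto simp: splits_def)
  then have "x = i \<or> y = i" using iso by (auto simp: nearest_iff isolates_def) 
  then obtain z where z: "z \<in> nearest (T - {t}) c Y" "i \<in> nearest (T - {t}) c Y" "z \<noteq> i" 
    using xy by metis
  have "odd (disagreement (T - {t}) c i l)"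
    using even iso l unfolding disagreement_remove[OF fin t] by (auto simp: isolates_def)
  moreover have "even (disagreement (T - {t}) c i z)"
    using nearest_even_disagreement[of "T - {t}"] fin z by blast
  ultimately have "z \<noteq> l" by auto
  then show ?thesis by (intro splitsI[OF z(2,1)]) (use z(3) in auto)
qed

lemma pair_column_weakly_better:
  assumes fin: "finite T" and t: "t \<in> T" and iso: "isolates (c t) i"
    and even: "even (disagreement T c i l)" and l: "l < 4" "l \<noteq> i"
  shows "weakly_better T (c(t := (\<lambda>j. j = i \<or> j = l))) c"
  by (rule column_weakly_better[OF fin t pair_column_splits[OF assms]])

lemma not_lone_pair: 
  assumes "row_labels i l p q" shows "\<not> lone (\<lambda>j. j = i \<or> j = l)"
  unfolding lone_iff[OF assms] using row_labels_distinct[OF assms] by auto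

lemma card_lone_replace:
  assumes fin: "finite T" and t: "t \<in> T" "lone (c t)" "\<not> lone b"
  shows "card {s \<in> T. lone (c s)} = Suc (card {s \<in> T. lone ((c(t := b)) s)})"
proof -
  have "{s \<in> T. lone (c s)} = insert t {s \<in> T. lone ((c(t := b)) s)}"
    "t \<notin> {s \<in> T. lone ((c(t := b)) s)}"
    using t by auto
  then show ?thesis using fin by simp
qed

section \<open>Codes in which every column divides the rows two against two\<close>

definition balanced :: "(nat \<Rightarrow> bool) \<Rightarrow> bool" where
  "balanced b \<longleftrightarrow> \<not> lone b \<and> \<not> (\<forall>j<4. b j = b 0)"

lemma balanced_iff:
  assumes L: "row_labels i l p q"
  shows "balanced b \<longleftrightarrow> pairs b i l p q \<or> pairs b i p l q \<or> pairs b i q l p"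
proof -
  have "0 \<in> {i, l, p, q}" using L by (simp add: row_labels_def)
  then show ?thesis unfolding balanced_def lone_iff[OF L] all_rows_labels[OF L] pairs_def by auto
qed

definition agree :: "nat set \<Rightarrow> (nat \<Rightarrow> nat \<Rightarrow> bool) \<Rightarrow> nat \<Rightarrow> nat \<Rightarrow> nat set" where
  "agree T c i j = {t \<in> T. c t i = c t j}"

text \<open>
The word in \<open>T\<close> that differs from row \<open>i\<close> exactly on \<open>X\<close>.
\<close>

definition word_at :: "nat set \<Rightarrow> (nat \<Rightarrow> nat \<Rightarrow> bool) \<Rightarrow> nat \<Rightarrow> nat set \<Rightarrow> nat set" where
  "word_at T c i X = {t \<in> T. c t i \<noteq> (t \<in> X)}"

lemma word_at_subset: "word_at T c i X \<subseteq> T"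
  by (auto simp: word_at_def)

lemma word_at_word_at: "Y \<subseteq> T \<Longrightarrow> word_at T c i (word_at T c i Y) = Y"
  by (auto simp: word_at_def)

lemma finite_agree: "finite T \<Longrightarrow> finite (agree T c i j)"
  by (simp add: agree_def)

text \<open>
Measured from row \<open>i\<close>, a word is seen by the other rows only through the number of its deviations in each
of the three pairings: the row paired with \<open>i\<close> sees a deviation as \<open>i\<close> does, the other two rows see it
complemented. The identities are stated with sums on both sides to avoid subtraction.
\<close>

lemma balanced_row_dists:
  assumes fin: "finite T" and L: "row_labels i l p q" and bal: "\<forall>t\<in>T. balanced (c t)"
  shows "row_dist T c (word_at T c i X) i
      = card (X \<inter> agree T c i l) + card (X \<inter> agree T c i p) + card (X \<inter> agree T c i q)"
    and "row_dist T c (word_at T c i X) l + card (X \<inter> agree T c i p) + card (X \<inter> agree T c i q)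
      = card (X \<inter> agree T c i l) + card (agree T c i p) + card (agree T c i q)"
    and "row_dist T c (word_at T c i X) p + card (X \<inter> agree T c i l) + card (X \<inter> agree T c i q)
      = card (X \<inter> agree T c i p) + card (agree T c i l) + card (agree T c i q)"
    and "row_dist T c (word_at T c i X) q + card (X \<inter> agree T c i l) + card (X \<inter> agree T c i p)
      = card (X \<inter> agree T c i q) + card (agree T c i l) + card (agree T c i p)"
proof -
  define Y where "Y = {t. c t i \<noteq> (t \<in> X)}"
  define x where "x T j = card {t \<in> T. t \<in> X \<and> c t i = c t j}" for T j
  define n where "n T j = card {t \<in> T. c t i = c t j}" for T j
  have "row_dist T c Y i = x T l + x T p + x T q \<and>
    row_dist T c Y l + x T p + x T q = x T l + n T p + n T q \<and>
    row_dist T c Y p + x T l + x T q = x T p + n T l + n T q \<and>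
    row_dist T c Y q + x T l + x T p = x T q + n T l + n T p"
    using fin bal
  proof (induction T rule: finite_induct)
    case empty
    then show ?case by (simp add: row_dist_def x_def n_def)
  next
    case (insert t T)
    have x: "x (insert t T) j = x T j + of_bool (t \<in> X \<and> c t i = c t j)" for j
      unfolding x_def by (rule card_filter_insert[OF insert.hyps])
    have n: "n (insert t T) j = n T j + of_bool (c t i = c t j)" for j
      unfolding n_def by (rule card_filter_insert[OF insert.hyps])
    have Y: "t \<in> Y \<longleftrightarrow> c t i \<noteq> (t \<in> X)" by (simp add: Y_def)
    have IH: "row_dist T c Y i = x T l + x T p + x T q"
      "row_dist T c Y l + x T p + x T q = x T l + n T p + n T q"
      "row_dist T c Y p + x T l + x T q = x T p + n T l + n T q"
      "row_dist T c Y q + x T l + x T p = x T q + n T l + n T p"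
      using insert by simp_all
    have "pairs (c t) i l p q \<or> pairs (c t) i p l q \<or> pairs (c t) i q l p"
      using insert.prems balanced_iff[OF L] by simp
    then show ?case
      unfolding row_dist_insert[OF insert.hyps] x n Y pairs_def
      by (elim disjE; cases "t \<in> X"; cases "c t i"; use IH in simp)
  qed
  moreover have "row_dist T c Y j = row_dist T c (word_at T c i X) j" for j
    by (rule row_dist_cong) (auto simp: Y_def word_at_def)
  moreover have "x T j = card (X \<inter> agree T c i j)" "n T j = card (agree T c i j)" for j
    unfolding x_def n_def agree_def by (auto intro: arg_cong[where f = card])
  ultimately show "row_dist T c (word_at T c i X) i
      = card (X \<inter> agree T c i l) + card (X \<inter> agree T c i p) + card (X \<inter> agree T c i q)"
    "row_dist T c (word_at T c i X) l + card (X \<inter> agree T c i p) + card (X \<inter> agree T c i q)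
      = card (X \<inter> agree T c i l) + card (agree T c i p) + card (agree T c i q)"
    "row_dist T c (word_at T c i X) p + card (X \<inter> agree T c i l) + card (X \<inter> agree T c i q)
      = card (X \<inter> agree T c i p) + card (agree T c i l) + card (agree T c i q)"
    "row_dist T c (word_at T c i X) q + card (X \<inter> agree T c i l) + card (X \<inter> agree T c i p)
      = card (X \<inter> agree T c i q) + card (agree T c i l) + card (agree T c i p)"
    by simp_all
qed

lemma balanced_agree:
  assumes L: "row_labels i l p q" and "balanced b"
  shows "b l \<noteq> b i \<or> b p \<noteq> b i" "b l \<noteq> b i \<or> b q \<noteq> b i" "b p \<noteq> b i \<or> b q \<noteq> b i"
  using assms(2) unfolding balanced_iff[OF L] pairs_def by auto

lemma disagreement_balanced:
  assumes fin: "finite T" and L: "row_labels i l p q" and bal: "\<forall>t\<in>T. balanced (c t)"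
  shows "disagreement T c i l = card (agree T c i p) + card (agree T c i q)"
proof -
  have eq: "(c t i \<noteq> c t l) \<longleftrightarrow> c t i = c t p \<or> c t i = c t q" if "t \<in> T" for t
  proof -
    have "pairs (c t) i l p q \<or> pairs (c t) i p l q \<or> pairs (c t) i q l p"
      using bal that balanced_iff[OF L] by simp
    then show ?thesis unfolding pairs_def by auto
  qed
  have "{t \<in> T. c t i \<noteq> c t l} = agree T c i p \<union> agree T c i q"
    unfolding agree_def using eq by blast
  moreover have "agree T c i p \<inter> agree T c i q = {}"
    unfolding agree_def using balanced_agree(3)[OF L] bal by auto
  ultimately show ?thesis
    unfolding disagreement_def using fin by (simp add: card_Un_disjoint finite_agree)
qed

lemma obtain_word_by_blocks:
  assumes fin: "finite T" and L: "row_labels i l p q" and bal: "\<forall>t\<in>T. balanced (c t)"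
    and le: "x \<le> card (agree T c i l)" "y \<le> card (agree T c i p)" "z \<le> card (agree T c i q)"
  obtains X where "card (X \<inter> agree T c i l) = x" "card (X \<inter> agree T c i p) = y"
    "card (X \<inter> agree T c i q) = z"
proof -
  obtain A B C where A: "A \<subseteq> agree T c i l" "card A = x" and B: "B \<subseteq> agree T c i p" "card B = y"
    and C: "C \<subseteq> agree T c i q" "card C = z"
    using le by (metis obtain_subset_with_card_n)
  have disj: "agree T c i l \<inter> agree T c i p = {}" "agree T c i l \<inter> agree T c i q = {}"
    "agree T c i p \<inter> agree T c i q = {}"
    unfolding agree_def using balanced_agree[OF L] bal by auto
  have "(A \<union> B \<union> C) \<inter> agree T c i l = A" "(A \<union> B \<union> C) \<inter> agree T c i p = B"
    "(A \<union> B \<union> C) \<inter> agree T c i q = C"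
    using A(1) B(1) C(1) disj by blast+
  then show ?thesis using that[of "A \<union> B \<union> C"] A(2) B(2) C(2) by simp
qed

lemma nearest_labels:
  assumes L: "row_labels i l p q"
  shows "j \<in> nearest T c Y \<longleftrightarrow> j < 4 \<and> row_dist T c Y j \<le> row_dist T c Y i \<and>
    row_dist T c Y j \<le> row_dist T c Y l \<and> row_dist T c Y j \<le> row_dist T c Y p \<and>
    row_dist T c Y j \<le> row_dist T c Y q"
  unfolding nearest_iff all_rows_labels[OF L] by simp

lemma nearest_subset_labels:
  assumes L: "row_labels i l p q" and "j \<in> nearest T c Y"
  shows "j = i \<or> j = l \<or> j = p \<or> j = q"
  using assms unfolding row_labels_def nearest_iff by (metis insertE lessThan_iff empty_iff)

lemma nearest_pair:
  assumes L: "row_labels i l p q"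
    and "row_dist T c Y i = row_dist T c Y l" "row_dist T c Y i < row_dist T c Y p"
      "row_dist T c Y i < row_dist T c Y q"
  shows "nearest T c Y = {i, l}"
proof -
  have "p \<notin> nearest T c Y" "q \<notin> nearest T c Y" "i \<in> nearest T c Y" "l \<in> nearest T c Y"
    using assms(2-) row_labels_less[OF L] by (auto simp: nearest_labels[OF L])
  then show ?thesis using nearest_subset_labels[OF L] by blast
qed

text \<open>
Rows \<open>i\<close> and \<open>l\<close> are equal, and so are \<open>p\<close> and \<open>q\<close>; hence every tie set contains both rows of one of
these pairs, and a column that separates both pairs splits all of them. For a strict gain the column that is
given up is a constant one if possible. If there is none, \<open>i\<close> and \<open>p\<close> are complementary, and row \<open>i\<close>
itself has a tie set that the old column does not split.
\<close>

lemma two_row_code_better: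
  assumes fin: "finite T" and L: "row_labels i l p q" and two: "card T \<ge> 2"
    and eq: "\<forall>t\<in>T. c t i = c t l \<and> c t p = c t q"
  shows "\<exists>c'. better T c' c"
proof -
  obtain t where t: "t \<in> T" "(\<exists>s\<in>T. c s i = c s p) \<longrightarrow> c t i = c t p"
    using two by (metis card.empty ex_in_conv not_numeral_le_zero)
  have same: "row_dist (T - {t}) c Y i = row_dist (T - {t}) c Y l"
    "row_dist (T - {t}) c Y p = row_dist (T - {t}) c Y q" for Y
    using eq by (intro row_dist_cong; simp)+
  have split: "splits (\<lambda>j. j = i \<or> j = p) (nearest (T - {t}) c Y)" for Y
  proof -
    obtain j where j: "j \<in> nearest (T - {t}) c Y" using nearest_nonempty by blast
    have "{i, l} \<subseteq> nearest (T - {t}) c Y \<or> {p, q} \<subseteq> nearest (T - {t}) c Y"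
      using j nearest_subset_labels[OF L j] row_labels_less[OF L]
      by (auto simp: nearest_labels[OF L] same)
    then show ?thesis
    proof
      assume "{i, l} \<subseteq> nearest (T - {t}) c Y"
      then show ?thesis using row_labels_distinct[OF L] by (intro splitsI[of i _ l]) auto
    next
      assume "{p, q} \<subseteq> nearest (T - {t}) c Y"
      then show ?thesis using row_labels_distinct[OF L] by (intro splitsI[of p _ q]) auto
    qed
  qed
  have "\<exists>Y \<subseteq> T - {t}. \<not> splits (c t) (nearest (T - {t}) c Y)"
  proof (cases "c t i = c t p")
    case True
    have "\<not> splits (c t) (nearest (T - {t}) c {})"
    proof
      assume "splits (c t) (nearest (T - {t}) c {})"
      then show False using nearest_subset_labels[OF L] True eq t(1) unfolding splits_def by metis
    qed
    then show ?thesis by blast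
  next
    case False
    then have ne: "\<forall>s\<in>T. c s i \<noteq> c s p" using t(2) by blast
    define Y where "Y = {s \<in> T - {t}. c s i}"
    have "{s \<in> T - {t}. c s i \<noteq> (s \<in> Y)} = {}" by (auto simp: Y_def)
    then have 0: "row_dist (T - {t}) c Y i = 0" unfolding row_dist_def by (simp only: card.empty)
    have "{s \<in> T - {t}. c s p \<noteq> (s \<in> Y)} = T - {t}" using ne by (auto simp: Y_def)
    then have "row_dist (T - {t}) c Y p = card (T - {t})" unfolding row_dist_def by (simp only:)
    then have "0 < row_dist (T - {t}) c Y p" using two t(1) fin by simp
    with 0 have "p \<notin> nearest (T - {t}) c Y" "q \<notin> nearest (T - {t}) c Y"
      by (auto simp: nearest_labels[OF L] same)
    then have "j = i \<or> j = l" if "j \<in> nearest (T - {t}) c Y" for j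
      using nearest_subset_labels[OF L that] that by blast
    then have "\<not> splits (c t) (nearest (T - {t}) c Y)"
      using eq t(1) unfolding splits_def by metis
    moreover have "Y \<subseteq> T - {t}" by (auto simp: Y_def)
    ultimately show ?thesis by blast
  qed
  then obtain Y where "Y \<subseteq> T - {t}" "\<not> splits (c t) (nearest (T - {t}) c Y)" by blast
  then have "better T (c(t := (\<lambda>j. j = i \<or> j = p))) c"
    using split by (intro column_better[OF fin t(1)])
  then show ?thesis by blast
qed

text \<open>
When the pairing of \<open>i\<close> with \<open>l\<close> does not occur, \<open>d\<^sub>i + d\<^sub>l = d\<^sub>p + d\<^sub>q\<close> for the distances of every word. So
a tie set containing \<open>i, l\<close> or \<open>p, q\<close> is the set of all rows, and nothing is lost by using a column of
the missing pairing. The set \<open>{i, q}\<close> is gained: it is the tie set of a word halfway between \<open>i\<close> and \<open>q\<close>.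
\<close>

lemma missing_pairing_better:
  assumes fin: "finite T" and L: "row_labels i l p q" and t: "t \<in> T" "pairs (c t) i q l p"
    and bal: "\<forall>s\<in>T - {t}. balanced (c s)"
    and none: "agree (T - {t}) c i l = {}" and even: "even (card (agree (T - {t}) c i p))"
    and pos: "card (agree (T - {t}) c i q) > 0"
  shows "better T (c(t := (\<lambda>j. j = i \<or> j = l))) c"
proof -
  have fin': "finite (T - {t})" using fin by simp
  note d = balanced_row_dists[OF fin' L bal]
  have sums: "row_dist (T - {t}) c Y i + row_dist (T - {t}) c Y l
      = row_dist (T - {t}) c Y p + row_dist (T - {t}) c Y q" for Y
  proof -
    have "row_dist (T - {t}) c (word_at (T - {t}) c i (word_at (T - {t}) c i Y)) j = row_dist (T - {t}) c Y j" for j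
      by (rule row_dist_cong) (auto simp: word_at_def)
    then show ?thesis using d[of "word_at (T - {t}) c i Y"] none by simp
  qed
  have ct: "c t i = c t q" "c t l = c t p" "c t i \<noteq> c t l" using t(2) by (auto simp: pairs_def)
  have dist: "i \<noteq> l" "i \<noteq> p" "i \<noteq> q" "l \<noteq> p" "l \<noteq> q" "p \<noteq> q" using row_labels_distinct[OF L] by auto
  have lt: "i < 4" "l < 4" "p < 4" "q < 4" using row_labels_less[OF L] by auto
  obtain X where X: "card (X \<inter> agree (T - {t}) c i l) = 0"
    "card (X \<inter> agree (T - {t}) c i p) = card (agree (T - {t}) c i p) div 2"
    "card (X \<inter> agree (T - {t}) c i q) = 0"
    by (rule obtain_word_by_blocks[OF fin' L bal, of 0 "card (agree (T - {t}) c i p) div 2" 0]) auto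
  define Y0 where "Y0 = word_at (T - {t}) c i X"
  have "row_dist (T - {t}) c Y0 i = row_dist (T - {t}) c Y0 q"
    "row_dist (T - {t}) c Y0 i < row_dist (T - {t}) c Y0 l"
    "row_dist (T - {t}) c Y0 i < row_dist (T - {t}) c Y0 p"
    using d[of X] X none even pos unfolding Y0_def by (auto elim!: evenE)
  then have M: "nearest (T - {t}) c Y0 = {i, q}"
    using row_labels_swap(2)[OF row_labels_swap(3)[OF L]] by (intro nearest_pair)
  show ?thesis
  proof (rule column_better[OF fin t(1)])
    show "Y0 \<subseteq> T - {t}" unfolding Y0_def by (rule word_at_subset)
    show "splits (\<lambda>j. j = i \<or> j = l) (nearest (T - {t}) c Y0)"
      unfolding M using dist by (intro splitsI[of i _ q]) auto
    show "\<not> splits (c t) (nearest (T - {t}) c Y0)"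
      unfolding M using ct by (auto simp: splits_def)
    show "splits (\<lambda>j. j = i \<or> j = l) (nearest (T - {t}) c Y)"
      if "splits (c t) (nearest (T - {t}) c Y)" for Y
    proof -
      let ?M = "nearest (T - {t}) c Y"
      have "i \<in> ?M \<and> l \<in> ?M \<longleftrightarrow> (i \<in> ?M \<and> l \<in> ?M \<and> p \<in> ?M \<and> q \<in> ?M)"
        "p \<in> ?M \<and> q \<in> ?M \<longleftrightarrow> (i \<in> ?M \<and> l \<in> ?M \<and> p \<in> ?M \<and> q \<in> ?M)"
        using sums[of Y] lt by (auto simp: nearest_labels[OF L])
      moreover have "(i \<in> ?M \<or> q \<in> ?M) \<and> (l \<in> ?M \<or> p \<in> ?M)"
        using that ct nearest_subset_labels[OF L] unfolding splits_def by metis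
      ultimately have "(i \<in> ?M \<or> l \<in> ?M) \<and> (p \<in> ?M \<or> q \<in> ?M)" by blast
      then show ?thesis
        using dist by (elim conjE disjE) (erule (1) splitsI, simp)+
    qed
  qed
qed

text \<open>
Pairing \<open>i\<close> with \<open>p\<close> loses nothing and gains the tie set \<open>{p, q}\<close>. It occurs at a word which agrees with
\<open>p\<close> and \<open>q\<close> wherever these two agree, and lies halfway between them elsewhere.
\<close>

lemma lone_replacement_strict:
  assumes fin: "finite T" and t: "t \<in> T" and iso: "isolates (c t) i" and L: "row_labels i l p q"
    and bal: "\<forall>s\<in>T - {t}. balanced (c s)"
    and even: "even (disagreement T c i p)" 
    and parity: "odd (disagreement (T - {t}) c i p)" "even (disagreement (T - {t}) c i l)"
    and pos: "card (agree (T - {t}) c i l) > 0"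
  shows "\<exists>c'. better T c' c"
proof -
  have fin': "finite (T - {t})" using fin by simp
  note d = balanced_row_dists[OF fin' L bal]
  let ?l = "card (agree (T - {t}) c i l)" and ?p = "card (agree (T - {t}) c i p)" 
    and ?q = "card (agree (T - {t}) c i q)"
  have dist: "i \<noteq> l" "i \<noteq> p" "i \<noteq> q" "l \<noteq> p" "l \<noteq> q" "p \<noteq> q" using row_labels_distinct[OF L] by auto
  have lt: "i < 4" "l < 4" "p < 4" "q < 4" using row_labels_less[OF L] by auto
  have par: "even (?p + ?q)" "odd (?l + ?q)"
    using disagreement_balanced[OF fin' L bal] parity(2)
      disagreement_balanced[OF fin' row_labels_swap(2)[OF L] bal] parity(1) by auto
  \<comment> \<open>Rounding both halves down keeps \<open>p\<close> and \<open>q\<close> equidistant, since \<open>?p\<close> and \<open>?q\<close> have equal parity.\<close>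
  obtain X where X: "card (X \<inter> agree (T - {t}) c i l) = ?l"
    "card (X \<inter> agree (T - {t}) c i p) = ?p div 2" "card (X \<inter> agree (T - {t}) c i q) = ?q div 2"
    by (rule obtain_word_by_blocks[OF fin' L bal, of ?l "?p div 2" "?q div 2"]) auto
  define Y0 where "Y0 = word_at (T - {t}) c i X"
  have "row_dist (T - {t}) c Y0 p = row_dist (T - {t}) c Y0 q"
    "row_dist (T - {t}) c Y0 p < row_dist (T - {t}) c Y0 i"
    "row_dist (T - {t}) c Y0 p < row_dist (T - {t}) c Y0 l"
    unfolding atomize_conj
  proof (cases "even ?q")
    case True
    then have "even ?p" using par by simp
    then show "row_dist (T - {t}) c Y0 p = row_dist (T - {t}) c Y0 q \<and>
      row_dist (T - {t}) c Y0 p < row_dist (T - {t}) c Y0 i \<and>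
      row_dist (T - {t}) c Y0 p < row_dist (T - {t}) c Y0 l"
      using True d[of X] X pos unfolding Y0_def by (elim evenE) simp
  next
    case False
    then have "odd ?p" "?l > 1" using par pos by (auto intro!: Suc_lessI)
    then show "row_dist (T - {t}) c Y0 p = row_dist (T - {t}) c Y0 q \<and>
      row_dist (T - {t}) c Y0 p < row_dist (T - {t}) c Y0 i \<and>
      row_dist (T - {t}) c Y0 p < row_dist (T - {t}) c Y0 l"
      using False d[of X] X unfolding Y0_def by (elim oddE) simp
  qed
  then have M: "nearest (T - {t}) c Y0 = {p, q}"
    using row_labels_rotate[OF L] by (intro nearest_pair)
  have "better T (c(t := (\<lambda>j. j = i \<or> j = p))) c"
  proof (rule column_better[OF fin t])
    show "Y0 \<subseteq> T - {t}" unfolding Y0_def by (rule word_at_subset)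
    show "splits (\<lambda>j. j = i \<or> j = p) (nearest (T - {t}) c Y0)"
      unfolding M using dist by (intro splitsI[of p _ q]) auto
    show "\<not> splits (c t) (nearest (T - {t}) c Y0)"
      unfolding M using iso lt dist by (auto simp: splits_def isolates_def)
  qed (use pair_column_splits[where l = p, OF fin t iso even] lt dist in auto)
  then show ?thesis by blast
qed

text \<open>
If the pairing of \<open>i\<close> with \<open>l\<close> is missing, the first replacement may be only an equality. It produces a
code to which \<open>missing_pairing_better\<close> applies.
\<close>

lemma two_step_replacement_better:
  assumes fin: "finite T" and t: "t \<in> T" and iso: "isolates (c t) i" and L: "row_labels i l p q"
    and bal: "\<forall>s\<in>T - {t}. balanced (c s)"
    and even: "even (disagreement T c i p)" 
    and none: "agree (T - {t}) c i l = {}"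
    and odd: "odd (card (agree (T - {t}) c i p))" 
    and large: "card (agree (T - {t}) c i q) > 1"
  shows "\<exists>c'. better T c' c"
proof -
  let ?c1 = "c(t := (\<lambda>j. j = i \<or> j = p))"
  have dist: "i \<noteq> l" "i \<noteq> p" "i \<noteq> q" "l \<noteq> p" "l \<noteq> q" "p \<noteq> q" using row_labels_distinct[OF L] by auto
  have lt: "i < 4" "l < 4" "p < 4" "q < 4" using row_labels_less[OF L] by auto
  have fin': "finite (T - {t})" using fin by simp
  obtain u where u: "u \<in> agree (T - {t}) c i q" using large by fastforce
  then have u': "u \<in> T" "u \<noteq> t" "c u i = c u q" by (auto simp: agree_def)
  have "pairs (c u) i q l p"
    using balanced_agree[OF L, of "c u"] bal u' unfolding balanced_iff[OF L] by (auto simp: pairs_def)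
  moreover have "balanced (?c1 t)" unfolding balanced_iff[OF L] pairs_def using dist by auto
  moreover have "agree (T - {u}) ?c1 i l = {}"
    using none dist by (auto simp: agree_def)
  moreover have "agree (T - {u}) ?c1 i p = insert t (agree (T - {t}) c i p)"
  proof -
    have "u \<notin> agree (T - {t}) c i p" using balanced_agree[OF L, of "c u"] bal u' by (auto simp: agree_def)
    then show ?thesis using t u' by (auto simp: agree_def)
  qed
  then have "card (agree (T - {u}) ?c1 i p) = Suc (card (agree (T - {t}) c i p))"
    using finite_agree[OF fin'] by (simp add: agree_def)
  moreover have "agree (T - {u}) ?c1 i q = agree (T - {t}) c i q - {u}"
    using dist by (auto simp: agree_def)
  then have "card (agree (T - {u}) ?c1 i q) > 0"
    using u large by simp
  ultimately have "better T (?c1(u := (\<lambda>j. j = i \<or> j = l))) ?c1"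
    using u' odd bal by (intro missing_pairing_better[OF fin L]) auto
  moreover have "weakly_better T ?c1 c"
    using pair_column_weakly_better[OF fin t iso even] lt dist by blast
  ultimately show ?thesis using better_trans by blast
qed

text \<open>
Here \<open>l\<close> is the row that is alone in its parity class, and the lone column separates another row \<open>i\<close>.
If the pairing of \<open>i\<close> with \<open>l\<close> is missing, the other two pairings occur an odd number of times each, and
more than three columns force one of them to occur at least three times.
\<close>

lemma single_lone_column_better:
  assumes fin: "finite T" and card: "card T > 3" and t: "t \<in> T" and iso: "isolates (c t) i"
    and L: "row_labels i l p q"
    and bal: "\<forall>s\<in>T - {t}. balanced (c s)"
    and even: "even (disagreement T c i p)" "even (disagreement T c i q)" and odd: "odd (disagreement T c i l)"
  shows "\<exists>c'. better T c' c"
proof (cases "agree (T - {t}) c i l = {}")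
  case False
  have fin': "finite (T - {t})" using fin by simp
  have "odd (disagreement (T - {t}) c i p)" "even (disagreement (T - {t}) c i l)"
    using even odd iso row_labels_less[OF L] row_labels_distinct[OF L]
    unfolding disagreement_remove[OF fin t] by (auto simp: isolates_def)
  then show ?thesis
    using lone_replacement_strict[OF fin t iso L bal even(1)] False finite_agree[OF fin'] by (simp add: card_gt_0_iff)
next
  case True
  have fin': "finite (T - {t})" using fin by simp
  let ?p = "card (agree (T - {t}) c i p)" and ?q = "card (agree (T - {t}) c i q)"
  have dis: "odd (disagreement (T - {t}) c i p)" "odd (disagreement (T - {t}) c i q)"
    using even iso row_labels_less[OF L] row_labels_distinct[OF L]
    unfolding disagreement_remove[OF fin t] by (auto simp: isolates_def)
  have swap: "row_labels i p l q" "row_labels i q p l" "row_labels i l q p"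
    using L row_labels_swap by blast+
  have odds: "odd ?q" "odd ?p"
    using dis disagreement_balanced[OF fin' swap(1) bal] disagreement_balanced[OF fin' swap(2) bal] True
    by auto
  have "T - {t} = agree (T - {t}) c i p \<union> agree (T - {t}) c i q"
    using bal True unfolding balanced_iff[OF L] by (auto simp: agree_def pairs_def)
  then have "card (T - {t}) \<le> ?p + ?q" by (metis card_Un_le)
  then have "?p + ?q \<ge> 3" using card t fin by simp
  then consider "?p > 1" | "?q > 1" using odds by (cases "?p > 1") auto
  then show ?thesis
  proof cases
    case 1
    then show ?thesis using two_step_replacement_better[OF fin t iso swap(3) bal even(2) True odds(1)] by simp
  next
    case 2
    then show ?thesis using two_step_replacement_better[OF fin t iso L bal even(1) True odds(2)] by simp
  qed
qed

section \<open>Comparing the weights of two kinds of ties\<close>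

lemma binomial_add_two:
  assumes "y \<le> m"
  shows "(Suc (Suc m) choose Suc y) * (Suc y * Suc (m - y)) = (m choose y) * (Suc m * Suc (Suc m))"
proof -
  have "Suc y * (Suc (Suc m) choose Suc y) = Suc (Suc m) * (Suc m choose y)"
    by (rule Suc_times_binomial)
  moreover have "Suc (m - y) * (Suc m choose y) = Suc m * (m choose y)"
    using binomial_absorb_comp[of "Suc m" y] assms by (simp add: Suc_diff_le)
  ultimately show ?thesis by (metis mult.assoc mult.commute)
qed

text \<open>
Lengthening a row of Pascal's triangle by two, with both positions moved by one, multiplies the coefficient
at \<open>x\<close> by \<open>(m + 1) (m + 2) / ((x + 1) (m - x + 1))\<close>. This factor is larger for the position farther from
the middle, which is \<open>x\<close>; hence the ratio of the coefficients at \<open>x\<close> and \<open>z\<close> grows in each step.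
\<close>

lemma binomial_shift_le:
  fixes a x z k :: nat
  assumes "x \<le> z" "x + z \<le> a"
  shows "(a choose x) * ((a + 2 * k) choose (z + k)) \<le> (a choose z) * ((a + 2 * k) choose (x + k))"
proof (induction k)
  case (Suc k)
  define m where "m = a + 2 * k"
  define A where "A = Suc (x + k) * Suc (m - (x + k))"
  define B where "B = Suc (z + k) * Suc (m - (z + k))"
  have le: "x + k \<le> m" "z + k \<le> m" using assms by (auto simp: m_def)
  have A: "(Suc (Suc m) choose Suc (x + k)) * A = (m choose (x + k)) * (Suc m * Suc (Suc m))"
    unfolding A_def by (rule binomial_add_two[OF le(1)])
  have B: "(Suc (Suc m) choose Suc (z + k)) * B = (m choose (z + k)) * (Suc m * Suc (Suc m))"
    unfolding B_def by (rule binomial_add_two[OF le(2)])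
  have "A \<le> B"
  proof -
    obtain d e where d: "z = x + d" and e: "a = x + z + e" using assms le_Suc_ex by metis
    have "m - (x + k) = x + d + e + k" "m - (z + k) = x + e + k" by (auto simp: m_def d e)
    then show ?thesis unfolding A_def B_def d by (simp add: algebra_simps)
  qed
  have "((a choose x) * (Suc (Suc m) choose Suc (z + k))) * (A * B)
      = (a choose x) * A * ((Suc (Suc m) choose Suc (z + k)) * B)"
    by (simp only: mult_ac)
  also have "\<dots> = (a choose x) * (m choose (z + k)) * A * (Suc m * Suc (Suc m))"
    by (simp only: B) (simp only: mult_ac)
  also have "\<dots> \<le> (a choose z) * (m choose (x + k)) * B * (Suc m * Suc (Suc m))"
    using Suc.IH \<open>A \<le> B\<close> unfolding m_def by (intro mult_le_mono[OF mult_le_mono order.refl])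
  also have "\<dots> = (a choose z) * B * ((Suc (Suc m) choose Suc (x + k)) * A)"
    by (simp only: A) (simp only: mult_ac)
  also have "\<dots> = ((a choose z) * (Suc (Suc m) choose Suc (x + k))) * (A * B)"
    by (simp only: mult_ac)
  finally have "(a choose x) * (Suc (Suc m) choose Suc (z + k)) * (A * B)
    \<le> (a choose z) * (Suc (Suc m) choose Suc (x + k)) * (A * B)" .
  moreover have "0 < A * B" by (simp add: A_def B_def)
  ultimately have "(a choose x) * (Suc (Suc m) choose Suc (z + k)) \<le> (a choose z) * (Suc (Suc m) choose Suc (x + k))"
    by (rule mult_right_le_imp_le)
  moreover have "a + 2 * Suc k = Suc (Suc m)" by (simp add: m_def)
  ultimately show ?case by (simp only: add_Suc_right)
qed (simp add: mult.commute)

lemma card_subsets_by_parts: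
  assumes fin: "finite A" "finite B" "finite E" and disj: "A \<inter> B = {}" "A \<inter> E = {}" "B \<inter> E = {}"
  shows "card {X \<in> Pow (A \<union> B \<union> E). card (X \<inter> A) = x \<and> card (X \<inter> B) = y \<and> card (X \<inter> E) = z}
    = (card A choose x) * (card B choose y) * (card E choose z)"
proof -
  let ?S = "{X. X \<subseteq> A \<and> card X = x} \<times> {X. X \<subseteq> B \<and> card X = y} \<times> {X. X \<subseteq> E \<and> card X = z}"
  have "bij_betw (\<lambda>X. (X \<inter> A, X \<inter> B, X \<inter> E))
    {X \<in> Pow (A \<union> B \<union> E). card (X \<inter> A) = x \<and> card (X \<inter> B) = y \<and> card (X \<inter> E) = z} ?S"
  proof (rule bij_betw_byWitness[where f' = "\<lambda>(P, Q, R). P \<union> Q \<union> R"])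
    have parts: "(P \<union> Q \<union> R) \<inter> A = P" "(P \<union> Q \<union> R) \<inter> B = Q" "(P \<union> Q \<union> R) \<inter> E = R"
      if "P \<subseteq> A" "Q \<subseteq> B" "R \<subseteq> E" for P Q R
      using that disj by blast+
    show "\<forall>S\<in>?S. (\<lambda>X. (X \<inter> A, X \<inter> B, X \<inter> E)) ((\<lambda>(P, Q, R). P \<union> Q \<union> R) S) = S"
      using parts by auto
    show "(\<lambda>(P, Q, R). P \<union> Q \<union> R) ` ?S
      \<subseteq> {X \<in> Pow (A \<union> B \<union> E). card (X \<inter> A) = x \<and> card (X \<inter> B) = y \<and> card (X \<inter> E) = z}"
    proof
      fix X assume "X \<in> (\<lambda>(P, Q, R). P \<union> Q \<union> R) ` ?S"
      then obtain P Q R where "X = P \<union> Q \<union> R" "P \<subseteq> A" "Q \<subseteq> B" "R \<subseteq> E" "card P = x" "card Q = y" "card R = z"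
        by auto
      then show "X \<in> {X \<in> Pow (A \<union> B \<union> E). card (X \<inter> A) = x \<and> card (X \<inter> B) = y \<and> card (X \<inter> E) = z}"
        using parts by auto
    qed
  qed auto
  then have "card {X \<in> Pow (A \<union> B \<union> E). card (X \<inter> A) = x \<and> card (X \<inter> B) = y \<and> card (X \<inter> E) = z} = card ?S"
    by (rule bij_betw_same_card)
  then show ?thesis using fin by (simp add: card_cartesian_product n_subsets)
qed

lemma sum_Pow_word_at:
  fixes f :: "nat set \<Rightarrow> 'b::comm_monoid_add"
  shows "(\<Sum>Y\<in>Pow T. f Y) = (\<Sum>X\<in>Pow T. f (word_at T c i X))"
  by (rule sum.reindex_bij_witness[of _ "word_at T c i" "word_at T c i"])
     (simp_all add: word_at_word_at word_at_subset)

lemma sum_Pow_by_parts: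
  fixes f :: "nat \<times> nat \<times> nat \<Rightarrow> real"
  assumes fin: "finite A" "finite B" "finite E" and disj: "A \<inter> B = {}" "A \<inter> E = {}" "B \<inter> E = {}"
  shows "(\<Sum>X\<in>Pow (A \<union> B \<union> E). f (card (X \<inter> A), card (X \<inter> B), card (X \<inter> E)))
    = (\<Sum>(x, y, z)\<in>{..card A} \<times> {..card B} \<times> {..card E}.
        real ((card A choose x) * (card B choose y) * (card E choose z)) * f (x, y, z))"
proof -
  have "(\<Sum>X\<in>Pow (A \<union> B \<union> E). f (card (X \<inter> A), card (X \<inter> B), card (X \<inter> E)))
    = (\<Sum>p\<in>{..card A} \<times> {..card B} \<times> {..card E}.
        real (card {X \<in> Pow (A \<union> B \<union> E). (card (X \<inter> A), card (X \<inter> B), card (X \<inter> E)) = p}) * f p)"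
    using fin by (intro sum_fun_comp) (auto intro!: card_mono)
  also have "\<dots> = (\<Sum>(x, y, z)\<in>{..card A} \<times> {..card B} \<times> {..card E}.
        real ((card A choose x) * (card B choose y) * (card E choose z)) * f (x, y, z))"
    by (rule sum.cong) (auto simp: card_subsets_by_parts[OF fin disj, symmetric] simp del: of_nat_mult)
  finally show ?thesis .
qed

lemma balanced_parts:
  assumes L: "row_labels i l p q" and bal: "\<forall>t\<in>T. balanced (c t)"
  shows "T = agree T c i l \<union> agree T c i p \<union> agree T c i q"
    "agree T c i l \<inter> agree T c i p = {}" "agree T c i l \<inter> agree T c i q = {}"
    "agree T c i p \<inter> agree T c i q = {}"
proof -
  show "T = agree T c i l \<union> agree T c i p \<union> agree T c i q"
    using bal unfolding balanced_iff[OF L] by (auto simp: agree_def pairs_def)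
qed (use balanced_agree[OF L] bal in \<open>auto simp: agree_def\<close>)

text \<open>
With \<open>x, y, z\<close> deviations from row \<open>i\<close> in the three pairings, the condition says that \<open>i\<close> and \<open>l\<close> are
equally near and strictly nearer than \<open>p\<close> and \<open>r\<close>; the distance to \<open>i\<close> is \<open>x + y + z\<close>.
\<close>

lemma pair_tie_weight_eq:
  fixes q :: real
  assumes fin: "finite T" and L: "row_labels i l p r" and bal: "\<forall>t\<in>T. balanced (c t)"
  shows "(\<Sum>Y\<in>Pow T. q ^ min_dist T c Y * of_bool (nearest T c Y = {i, l}))
    = (\<Sum>(x, y, z)\<in>{..card (agree T c i l)} \<times> {..card (agree T c i p)} \<times> {..card (agree T c i r)}.
        real ((card (agree T c i l) choose x) * (card (agree T c i p) choose y) * (card (agree T c i r) choose z))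
        * (q ^ (x + y + z) * of_bool (2 * (y + z) = card (agree T c i p) + card (agree T c i r)
          \<and> 2 * (x + z) < card (agree T c i l) + card (agree T c i r)
          \<and> 2 * (x + y) < card (agree T c i l) + card (agree T c i p))))"
proof -
  note parts = balanced_parts[OF L bal]
  define f where "f = (\<lambda>(x, y, z). q ^ (x + y + z) * 
      (of_bool (2 * (y + z) = card (agree T c i p) + card (agree T c i r)
          \<and> 2 * (x + z) < card (agree T c i l) + card (agree T c i r)
          \<and> 2 * (x + y) < card (agree T c i l) + card (agree T c i p)) :: real))"
  have "q ^ min_dist T c (word_at T c i X) * of_bool (nearest T c (word_at T c i X) = {i, l})
      = f (card (X \<inter> agree T c i l), card (X \<inter> agree T c i p), card (X \<inter> agree T c i r))" for X
  proof -
    let ?Y = "word_at T c i X"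
    note d = balanced_row_dists[OF fin L bal, of X]
    have "nearest T c ?Y = {i, l} \<longleftrightarrow> row_dist T c ?Y i = row_dist T c ?Y l
        \<and> row_dist T c ?Y i < row_dist T c ?Y p \<and> row_dist T c ?Y i < row_dist T c ?Y r" (is "?P \<longleftrightarrow> ?Q")
    proof
      assume P: ?P
      then have "i \<in> nearest T c ?Y" "l \<in> nearest T c ?Y" "p \<notin> nearest T c ?Y" "r \<notin> nearest T c ?Y"
        using row_labels_distinct[OF L] by auto
      then show ?Q using row_labels_less[OF L] by (auto simp: nearest_labels[OF L])
    qed (use nearest_pair[OF L] in blast)
    also have "\<dots> \<longleftrightarrow> 2 * (card (X \<inter> agree T c i p) + card (X \<inter> agree T c i r)) = card (agree T c i p) + card (agree T c i r)
          \<and> 2 * (card (X \<inter> agree T c i l) + card (X \<inter> agree T c i r)) < card (agree T c i l) + card (agree T c i r)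
          \<and> 2 * (card (X \<inter> agree T c i l) + card (X \<inter> agree T c i p)) < card (agree T c i l) + card (agree T c i p)"
      using d by auto
    finally have iff: "nearest T c ?Y = {i, l} \<longleftrightarrow> \<dots>" .
    have min: "min_dist T c ?Y = row_dist T c ?Y i" if "nearest T c ?Y = {i, l}"
    proof -
      have "i \<in> nearest T c ?Y" using that by simp
      then show ?thesis by (simp add: nearest_def)
    qed
    show ?thesis
    proof (cases "nearest T c ?Y = {i, l}")
      case True
      then show ?thesis unfolding f_def prod.case iff[symmetric] min[OF True] d(1) by simp
    next
      case False
      then show ?thesis unfolding f_def prod.case iff[symmetric] by simp
    qed
  qed
  then have "(\<Sum>Y\<in>Pow T. q ^ min_dist T c Y * of_bool (nearest T c Y = {i, l}))
    = (\<Sum>X\<in>Pow T. f (card (X \<inter> agree T c i l), card (X \<inter> agree T c i p), card (X \<inter> agree T c i r)))"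
    by (subst sum_Pow_word_at[of _ T c i]) simp
  also have "\<dots> = (\<Sum>X\<in>Pow (agree T c i l \<union> agree T c i p \<union> agree T c i r).
       f (card (X \<inter> agree T c i l), card (X \<inter> agree T c i p), card (X \<inter> agree T c i r)))"
    using parts(1) by simp
  finally show ?thesis
    unfolding sum_Pow_by_parts[OF finite_agree finite_agree finite_agree parts(2-4), OF fin fin fin]
    by (simp add: f_def)
qed

text \<open>
Interchange the deviations from the middle in the two pairings: \<open>x\<close> of \<open>a\<close> and \<open>y\<close> of \<open>a + 2 k\<close> become
\<open>y - k\<close> of \<open>a\<close> and \<open>x + k\<close> of \<open>a + 2 k\<close>. This preserves the distance, takes ties of \<open>i, l\<close> to ties of
\<open>i, p\<close>, and does not lower the number of words with the given deviations.
\<close>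

lemma pair_tie_weight_mono:
  fixes q :: real
  assumes fin: "finite T" and L: "row_labels i l p r" and bal: "\<forall>t\<in>T. balanced (c t)"
    and le: "card (agree T c i l) \<le> card (agree T c i p)"
    and even: "even (card (agree T c i l) + card (agree T c i p))" and q: "0 \<le> q"
  shows "(\<Sum>Y\<in>Pow T. q ^ min_dist T c Y * of_bool (nearest T c Y = {i, l}))
    \<le> (\<Sum>Y\<in>Pow T. q ^ min_dist T c Y * of_bool (nearest T c Y = {i, p}))"
proof -
  define a n where "a = card (agree T c i l)" and "n = card (agree T c i r)"
  obtain k where k: "card (agree T c i p) = a + 2 * k"
    using le even unfolding a_def by (metis add.assoc add_diff_inverse_nat dvd_def even_add leD le_Suc_ex odd_add)
  let ?F = "\<lambda>(x, y, z). real ((a choose x) * (a + 2 * k choose y) * (n choose z))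
        * (q ^ (x + y + z) * of_bool (2 * (y + z) = a + 2 * k + n \<and> 2 * (x + z) < a + n
          \<and> 2 * (x + y) < a + (a + 2 * k)))"
  let ?G = "\<lambda>(y, x, z). real ((a + 2 * k choose y) * (a choose x) * (n choose z))
        * (q ^ (y + x + z) * of_bool (2 * (x + z) = a + n \<and> 2 * (y + z) < a + 2 * k + n
          \<and> 2 * (y + x) < a + 2 * k + a))"
  let ?S = "{(x, y, z). (x, y, z) \<in> {..a} \<times> {..a + 2 * k} \<times> {..n} \<and> 2 * (y + z) = a + 2 * k + n
    \<and> 2 * (x + z) < a + n \<and> 2 * (x + y) < a + (a + 2 * k)}"
  have "sum ?F ({..a} \<times> {..a + 2 * k} \<times> {..n}) = sum ?F ?S"
    by (rule sum.mono_neutral_right) auto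
  also have "\<dots> \<le> sum ?G ({..a + 2 * k} \<times> {..a} \<times> {..n})"
  proof (rule sum_le_included[where i = "\<lambda>(y, x, z). (y - k, x + k, z)"])
    show "finite ?S" by (rule finite_subset[of _ "{..a} \<times> {..a + 2 * k} \<times> {..n}"]) auto
    show "\<forall>p\<in>?S. \<exists>p'\<in>{..a + 2 * k} \<times> {..a} \<times> {..n}.
      (case p' of (y, x, z) \<Rightarrow> (y - k, x + k, z)) = p \<and> ?F p \<le> ?G p'"
    proof
      fix p assume "p \<in> ?S"
      then obtain x y z where p: "p = (x, y, z)" and le: "x \<le> a" "y \<le> a + 2 * k" "z \<le> n"
        and c: "2 * (y + z) = a + 2 * k + n" "2 * (x + z) < a + n" "2 * (x + y) < a + (a + 2 * k)"
        by auto
      define y' where "y' = y - k"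
      have y: "y = y' + k" "x < y'" "x + y' \<le> a" using c by (auto simp: y'_def)
      have "(a choose x) * (a + 2 * k choose y) \<le> (a choose y') * (a + 2 * k choose (x + k))"
        using binomial_shift_le[of x y' a k] y by simp
      then have "real ((a choose x) * (a + 2 * k choose y) * (n choose z))
          \<le> real ((a + 2 * k choose (x + k)) * (a choose y') * (n choose z))"
        by (simp only: of_nat_le_iff mult_le_mono1 mult.commute[of "a choose y'"])
      then have le0: "real ((a choose x) * (a + 2 * k choose y) * (n choose z)) * q ^ (x + y + z)
          \<le> real ((a + 2 * k choose (x + k)) * (a choose y') * (n choose z)) * q ^ (x + y + z)"
        by (rule mult_right_mono) (use q in simp)
      have F: "?F p = real ((a choose x) * (a + 2 * k choose y) * (n choose z)) * q ^ (x + y + z)"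
        using c unfolding p by (simp del: of_nat_mult)
      have e: "x + k + y' + z = x + y + z" using y by simp
      have "2 * (y' + z) = a + n" "2 * (x + k + z) < a + 2 * k + n"
        "2 * (x + k + y') < a + 2 * k + a"
        using c y by auto
      then have G: "?G (x + k, y', z)
          = real ((a + 2 * k choose (x + k)) * (a choose y') * (n choose z)) * q ^ (x + y + z)"
        by (simp add: e del: of_nat_mult)
      have "?F p \<le> ?G (x + k, y', z)" unfolding F G by (rule le0)
      moreover have "(x + k, y', z) \<in> {..a + 2 * k} \<times> {..a} \<times> {..n}" using le y by auto
      moreover have "(case (x + k, y', z) of (y, x, z) \<Rightarrow> (y - k, x + k, z)) = p" using p y by simp
      ultimately show "\<exists>p'\<in>{..a + 2 * k} \<times> {..a} \<times> {..n}.
        (case p' of (y, x, z) \<Rightarrow> (y - k, x + k, z)) = p \<and> ?F p \<le> ?G p'" by blast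
    qed
  qed (use q in auto)
  finally have "sum ?F ({..a} \<times> {..a + 2 * k} \<times> {..n}) \<le> sum ?G ({..a + 2 * k} \<times> {..a} \<times> {..n})" .
  then show ?thesis
    unfolding pair_tie_weight_eq[OF fin L bal] pair_tie_weight_eq[OF fin row_labels_swap(2)[OF L] bal]
      a_def[symmetric] n_def[symmetric] k .
qed


lemma agree_sym: "agree T c i j = agree T c j i"
  by (auto simp: agree_def)

text \<open>
A pairing is determined by the partner of any one row.
\<close>

lemma agree_opposite:
  assumes L: "row_labels i l p q" and bal: "\<forall>t\<in>T. balanced (c t)"
  shows "agree T c i l = agree T c p q"
  using bal unfolding agree_def balanced_iff[OF L] pairs_def by blast

text \<open>
The column that pairs \<open>o'\<close> with \<open>a\<close> fails to split, among the tie sets split by the lone column, only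
\<open>{o', a}\<close>; it gains \<open>{o', b}\<close>, \<open>{o', e}\<close> and \<open>{o', b, e}\<close>. The weight of the lost set is at most that
of \<open>{o', b}\<close>, because the pairing of \<open>o'\<close> with \<open>a\<close> is the rarer one. Strictness comes from a word whose
tie set contains \<open>o'\<close> and \<open>e\<close> but not \<open>a\<close>.
\<close>

lemma lone_column_least_pairing_better:
  assumes fin: "finite T" and t: "t \<in> T" and iso: "isolates (c t) a" and L: "row_labels o' a b e"
    and bal: "\<forall>s\<in>T - {t}. balanced (c s)"
    and le: "card (agree (T - {t}) c o' a) \<le> card (agree (T - {t}) c o' b)"
      "card (agree (T - {t}) c o' b) \<le> card (agree (T - {t}) c o' e)"
    and parity: "even (card (agree (T - {t}) c o' a) + card (agree (T - {t}) c o' b))"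
      "even (card (agree (T - {t}) c o' b) + card (agree (T - {t}) c o' e))"
    and nonempty: "card (T - {t}) > 0"
  shows "better T (c(t := (\<lambda>j. j = o' \<or> j = a))) c"
  unfolding better_def
proof safe
  fix q :: real assume q: "0 < q" "q < 1"
  define S where "S = T - {t}"
  have finS: "finite S" and balS: "\<forall>s\<in>S. balanced (c s)" using fin bal by (simp_all add: S_def)
  let ?a = "card (agree S c o' a)" and ?b = "card (agree S c o' b)" and ?e = "card (agree S c o' e)"
  let ?new = "\<lambda>j. j = o' \<or> j = a"
  have dist: "o' \<noteq> a" "o' \<noteq> b" "o' \<noteq> e" "a \<noteq> b" "a \<noteq> e" "b \<noteq> e" using row_labels_distinct[OF L] by auto
  have lt: "o' < 4" "a < 4" "b < 4" "e < 4" using row_labels_less[OF L] by auto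
  have ct: "c t o' \<noteq> c t a" "c t b = c t o'" "c t e = c t o'"
    using iso dist lt by (auto simp: isolates_def)
  let ?diff = "\<lambda>Y. of_bool (splits ?new (nearest S c Y)) - of_bool (splits (c t) (nearest S c Y)) :: real"
  let ?ties = "\<lambda>Y. of_bool (nearest S c Y = {o', b}) - of_bool (nearest S c Y = {o', a}) :: real"
  have ties_le: "?ties Y \<le> ?diff Y" for Y
  proof -
    have sub: "nearest S c Y \<subseteq> {o', a, b, e}" using nearest_subset_labels[OF L] by blast
    have "splits ?new (nearest S c Y)" if split: "splits (c t) (nearest S c Y)" and ne: "nearest S c Y \<noteq> {o', a}"
    proof -
      obtain u v where uv: "u \<in> nearest S c Y" "v \<in> nearest S c Y" "c t u \<noteq> c t v"
        using split by (auto simp: splits_def)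
      then have "u = a \<and> v \<noteq> a \<or> v = a \<and> u \<noteq> a" using sub ct by auto
      then obtain x where x: "x \<in> nearest S c Y" "x \<noteq> a" "a \<in> nearest S c Y" using uv by blast
      then obtain y where "y \<in> nearest S c Y" "y = b \<or> y = e" using ne sub by blast
      then show ?thesis using x(3) dist by (intro splitsI[of a _ y]) auto
    qed
    moreover have "splits ?new {o', b}" "\<not> splits (c t) {o', b}"
      using dist ct by (auto simp: splits_def)
    moreover have "{o', a} \<noteq> {o', b}" using dist by auto
    ultimately show ?thesis by (auto split: if_splits)
  qed
  have "\<exists>X. a \<notin> nearest S c (word_at S c o' X) \<and> {o', e} \<subseteq> nearest S c (word_at S c o' X)"
  proof -
    \<comment> \<open>In the even case the word is in the middle for the pairings with \<open>a\<close> and \<open>b\<close> and agrees with \<open>o'\<close> in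
        the pairing with \<open>e\<close>, which occurs since it is the most frequent one; the tie set is \<open>{o', e}\<close>. In the odd
        case it is as near to the middle as possible for all three, and rounding up only for the pairing with
        \<open>a\<close> makes the tie set \<open>{o', b, e}\<close>.\<close>
    define x where "x = (if even ?a then ?a div 2 else Suc (?a div 2))"
    have "x \<le> ?a" by (auto simp: x_def elim: oddE)
    then obtain X where X: "card (X \<inter> agree S c o' a) = x" "card (X \<inter> agree S c o' b) = ?b div 2"
      "card (X \<inter> agree S c o' e) = (if even ?a then 0 else ?e div 2)"
      by (rule obtain_word_by_blocks[OF finS L balS, of x "?b div 2" "if even ?a then 0 else ?e div 2"]) auto
    let ?Y = "word_at S c o' X"
    note d = balanced_row_dists[OF finS L balS, of X]
    have sum: "card S = ?a + ?b + ?e"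
    proof -
      note parts = balanced_parts[OF L balS]
      have "card S = card (agree S c o' a \<union> agree S c o' b \<union> agree S c o' e)" using parts(1) by simp
      then show ?thesis
        using finS parts(2-4) by (simp add: card_Un_disjoint finite_agree Int_Un_distrib2)
    qed
    have les: "?a \<le> ?b" "?b \<le> ?e" "even (?a + ?b)" "even (?b + ?e)" "card S > 0"
      using le parity nonempty by (simp_all add: S_def)
    have "row_dist S c ?Y o' < row_dist S c ?Y a \<and> row_dist S c ?Y o' = row_dist S c ?Y e
      \<and> row_dist S c ?Y o' \<le> row_dist S c ?Y b"
    proof (cases "even ?a")
      case True
      then have "even ?b" "even ?e" using les by auto
      moreover have "?e \<noteq> 0" using les sum by auto
      ultimately show ?thesis using True d X les unfolding x_def by (auto elim!: evenE)
    next
      case False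
      then have "odd ?b" "odd ?e" using les by auto
      then show ?thesis using False d X unfolding x_def by (auto elim!: oddE)
    qed
    then have "a \<notin> nearest S c ?Y \<and> {o', e} \<subseteq> nearest S c ?Y"
      using lt by (auto simp: nearest_labels[OF L])
    then show ?thesis by blast
  qed
  then obtain Y0 where Y0: "Y0 \<subseteq> S" "a \<notin> nearest S c Y0" "o' \<in> nearest S c Y0" "e \<in> nearest S c Y0"
    using word_at_subset by (metis insert_subset)
  have "\<not> splits (c t) (nearest S c Y0)"
    using Y0(2) ct nearest_subset_labels[OF L, of _ S c Y0] unfolding splits_def by metis
  moreover have "splits ?new (nearest S c Y0)" using Y0 dist by (intro splitsI[of o' _ e]) auto
  moreover have "nearest S c Y0 \<noteq> {o', b}" "nearest S c Y0 \<noteq> {o', a}" using Y0 dist by auto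
  ultimately have strict: "?ties Y0 < ?diff Y0" by simp
  have "0 \<le> (\<Sum>Y\<in>Pow S. q ^ min_dist S c Y * ?ties Y)"
    using pair_tie_weight_mono[OF finS L balS, of q] le(1) parity(1) q
    by (simp add: S_def right_diff_distrib sum_subtractf)
  also have "\<dots> < (\<Sum>Y\<in>Pow S. q ^ min_dist S c Y * ?diff Y)"
  proof (rule sum_strict_mono_ex1)
    show "finite (Pow S)" using finS by simp
    show "\<forall>Y\<in>Pow S. q ^ min_dist S c Y * ?ties Y \<le> q ^ min_dist S c Y * ?diff Y"
      using ties_le q by (intro ballI mult_left_mono) auto
    show "\<exists>Y\<in>Pow S. q ^ min_dist S c Y * ?ties Y < q ^ min_dist S c Y * ?diff Y"
      using strict q Y0(1) by (intro bexI[of _ Y0] mult_strict_left_mono) auto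
  qed
  finally have "0 < weight_sum T (c(t := ?new)) q - weight_sum T c q"
    using weight_sum_column_diff[OF fin t, of c ?new q] q by (simp add: S_def)
  then show "weight_sum T c q < weight_sum T (c(t := ?new)) q" by simp
qed

text \<open>
Sort the three other rows by how often they are paired with \<open>a\<close>. The rarest partner takes the part of
\<open>o'\<close> in \<open>lone_column_least_pairing_better\<close>.
\<close>

lemma single_isolating_column_better:
  assumes fin: "finite T" and card: "card T > 1" and t: "t \<in> T" and iso: "isolates (c t) a"
    and L: "row_labels a x y z" and bal: "\<forall>s\<in>T - {t}. balanced (c s)"
    and odd: "odd (disagreement T c a x)" "odd (disagreement T c a y)"
  shows "\<exists>c'. better T c' c"
proof -
  define N where "N j = card (agree (T - {t}) c a j)" for j
  have fin': "finite (T - {t})" using fin by simp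
  have "even (disagreement (T - {t}) c a x)" "even (disagreement (T - {t}) c a y)"
    using odd iso row_labels_less[OF L] row_labels_distinct[OF L]
    unfolding disagreement_remove[OF fin t] by (auto simp: isolates_def)
  then have even: "even (N y + N z)" "even (N x + N z)"
    using disagreement_balanced[OF fin' L bal] disagreement_balanced[OF fin' row_labels_swap(2)[OF L] bal]
    by (simp_all add: N_def)
  have main: ?thesis if L': "row_labels a o' e b" and le: "N o' \<le> N e" "N e \<le> N b"
    and ev: "even (N o' + N e)" "even (N e + N b)" for o' e b
  proof -
    have L2: "row_labels o' a e b" and L3: "row_labels a e o' b"
      using L' row_labels_swap by blast+
    have "agree (T - {t}) c o' e = agree (T - {t}) c a b"
      using agree_opposite[OF row_labels_swap(2)[OF L2] bal] .
    moreover have "agree (T - {t}) c o' b = agree (T - {t}) c a e"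
      using agree_opposite[OF L3 bal] by simp
    ultimately have "better T (c(t := (\<lambda>j. j = o' \<or> j = a))) c"
      using le ev card t fin
      by (intro lone_column_least_pairing_better[OF fin t iso row_labels_swap(3)[OF L2] bal])
         (simp_all add: N_def agree_sym[of _ _ o' a] add.commute)
    then show ?thesis by blast
  qed
  have perms: "row_labels a x y z" "row_labels a x z y" "row_labels a y x z" "row_labels a y z x"
    "row_labels a z x y" "row_labels a z y x"
    using L row_labels_swap by blast+
  have ev: "even (N u + N v)" if "u \<in> {x, y, z}" "v \<in> {x, y, z}" for u v
    using that even by auto
  consider "N x \<le> N y" "N y \<le> N z" | "N x \<le> N z" "N z \<le> N y" | "N y \<le> N x" "N x \<le> N z"
    | "N y \<le> N z" "N z \<le> N x" | "N z \<le> N x" "N x \<le> N y" | "N z \<le> N y" "N y \<le> N x"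
    by linarith
  then show ?thesis by cases (use main perms ev in \<open>simp_all\<close>)
qed

section \<open>Removing the lone columns one at a time\<close>

text \<open>
The three ways of dividing the rows into two pairs each give one pair at even and one at odd distance;
since even distance is transitive, the even pairs form a triangle.
\<close>

lemma odd_lone_isolated_row:
  assumes fin: "finite T" and odd: "odd (card {t \<in> T. lone (c t)})"
  obtains r x y z where "row_labels r x y z"
    "odd (disagreement T c r x)" "odd (disagreement T c r y)" "odd (disagreement T c r z)"
    "even (disagreement T c x y)" "even (disagreement T c x z)" "even (disagreement T c y z)"
proof -
  let ?D = "disagreement T c"
  obtain u v :: nat where L: "row_labels 0 1 u v" using row_labels_exist[of 0 1] by auto
  have compl: "even (?D 0 1) \<longleftrightarrow> odd (?D u v)" "even (?D 0 u) \<longleftrightarrow> odd (?D 1 v)" "even (?D 0 v) \<longleftrightarrow> odd (?D 1 u)"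
    using even_disagreement_lone[OF fin L, of c] even_disagreement_lone[OF fin row_labels_swap(2)[OF L], of c]
      even_disagreement_lone[OF fin row_labels_swap(2)[OF row_labels_swap(3)[OF L]], of c] odd by auto
  have tr: "even (?D 0 1 + ?D 1 u + ?D 0 u)" using disagreement_parity_trans[OF fin] .
  have sym: "?D i j = ?D j i" for i j by (rule disagreement_sym)
  consider "odd (?D 0 1)" "odd (?D 0 u)" | "odd (?D 0 1)" "even (?D 0 u)"
    | "even (?D 0 1)" "odd (?D 0 u)" | "even (?D 0 1)" "even (?D 0 u)" by blast
  then show ?thesis
  proof cases
    case 1
    then show ?thesis using compl tr by (intro that[OF L]) auto
  next
    case 2
    then show ?thesis using compl tr sym by (intro that[OF row_labels_swap(1)[OF L]]) (auto simp: sym[of "Suc 0" 0])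
  next
    case 3
    then show ?thesis using compl tr 
      by (intro that[OF row_labels_rotate[OF L]])
        (auto simp: sym[of u 0] sym[of u "Suc 0"] sym[of v 0] sym[of v "Suc 0"] sym[of v u])
  next
    case 4
    then show ?thesis using compl tr 
      by (intro that[OF row_labels_rotate[OF row_labels_swap(3)[OF L]]])
        (auto simp: sym[of u 0] sym[of u "Suc 0"] sym[of v 0] sym[of v "Suc 0"] sym[of v u])
  qed
qed

text \<open>
Otherwise the other three rows would have even distances from each other, while complementary pairs
have distances of equal parity.
\<close>

lemma even_lone_even_partner:
  assumes fin: "finite T" and L: "row_labels i l p q" and even: "even (card {t \<in> T. lone (c t)})"
  shows "even (disagreement T c i l) \<or> even (disagreement T c i p) \<or> even (disagreement T c i q)"
  using even_disagreement_lone[OF fin row_labels_swap(2)[OF row_labels_swap(3)[OF L]], of c]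
    disagreement_parity_trans[OF fin, of c i l p] even by auto

text \<open>
The assumption \<open>isolated\<close> is the one descent step that cannot be made by comparing tie sets: an odd number
of at least three lone columns, all separating the row that is alone in its parity class.
\<close>

lemma lone_code_better:
  assumes fin: "finite T" and card: "card T > 3"
    and isolated: "\<And>c r. r < 4 \<Longrightarrow> 3 \<le> card {t \<in> T. lone (c t)} \<Longrightarrow> odd (card {t \<in> T. lone (c t)})
      \<Longrightarrow> \<forall>t\<in>T. isolates (c t) r \<or> balanced (c t)
      \<Longrightarrow> \<forall>i<4. \<forall>j<4. i \<noteq> r \<longrightarrow> j \<noteq> r \<longrightarrow> even (disagreement T c i j)
      \<Longrightarrow> \<exists>c'. weakly_better T c' c \<and> card {t \<in> T. lone (c t)} = Suc (card {t \<in> T. lone (c' t)})"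
    and pos: "card {t \<in> T. lone (c t)} > 0"
  shows "\<exists>c'. better T c' c"
  using pos
proof (induction "card {t \<in> T. lone (c t)}" arbitrary: c rule: less_induct)
  case less
  let ?k = "card {t \<in> T. lone (c t)}"
  have descend: ?case if "weakly_better T c' c" "?k = Suc (card {t \<in> T. lone (c' t)})" "?k > 1" for c'
  proof -
    have "\<exists>c''. better T c'' c'" by (rule less.hyps) (use that in auto)
    then show ?thesis using better_trans that(1) by blast
  qed
  have pair: ?case if t: "t \<in> T" "isolates (c t) i" and L: "row_labels i l p q"
    and ev: "even (disagreement T c i l)" and k: "?k > 1" for t i l p q
  proof (rule descend[OF _ _ k])
    show "weakly_better T (c(t := (\<lambda>j. j = i \<or> j = l))) c"
      using row_labels_less[OF L] row_labels_distinct[OF L]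
      by (intro pair_column_weakly_better[OF fin t ev]) auto
    show "?k = Suc (card {s \<in> T. lone ((c(t := (\<lambda>j. j = i \<or> j = l))) s)})"
      using t not_lone_pair[OF L] by (intro card_lone_replace[OF fin]) (auto simp: lone_def)
  qed
  obtain t where t: "t \<in> T" "lone (c t)" using less.prems by (auto simp: card_gt_0_iff)
  show ?case
  proof (cases "even ?k")
    case True
    then have "?k \<noteq> 1" by auto
    then have k: "?k > 1" using less.prems by linarith
    obtain i where i: "isolates (c t) i" using t(2) by (auto simp: lone_def)
    then have "i < 4" by (rule isolates_less)
    \<comment> \<open>Any row other than \<open>i\<close> would do.\<close>
    define l where "l = (if i = 0 then 1 else 0 :: nat)"
    have "l < 4" "i \<noteq> l" by (auto simp: l_def)
    then obtain p q where L: "row_labels i l p q" using row_labels_exist \<open>i < 4\<close> by blast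
    have flip: "disagreement T c i j = Suc (disagreement (T - {t}) c i j)" if "j \<in> {l, p, q}" for j
      using i row_labels_less[OF L] row_labels_distinct[OF L] that
      unfolding disagreement_remove[OF fin t(1)] by (auto simp: isolates_def)
    show ?thesis
    proof (cases "even (disagreement T c i l) \<and> even (disagreement T c i p) \<and> even (disagreement T c i q)")
      case True
      have "c t l = c t p" "c t p = c t q" using i unfolding isolates_labels[OF L] by auto
      then obtain b where "better T (c(t := b)) c"
        using odd_row_column_better[OF fin t(1) L] True flip by auto
      then show ?thesis by blast
    next
      case False
      note perms = L row_labels_swap(2)[OF L] row_labels_swap(2)[OF row_labels_swap(3)[OF L]]
      show ?thesis
        using even_lone_even_partner[OF fin L True] pair[OF t(1) i _ _ k] perms by blast
    qed
  next
    case False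
    obtain r x y z where L: "row_labels r x y z"
      and od: "odd (disagreement T c r x)" "odd (disagreement T c r y)" "odd (disagreement T c r z)"
      and ev: "even (disagreement T c x y)" "even (disagreement T c x z)" "even (disagreement T c y z)"
      by (rule odd_lone_isolated_row[OF fin False])
    have od': "\<forall>j<4. j \<noteq> r \<longrightarrow> odd (disagreement T c r j)"
      unfolding all_rows_labels[OF L] using od by simp
    have ev': "even (disagreement T c i j)" if "i < 4" "j < 4" "i \<noteq> r" "j \<noteq> r" for i j
      using disagreement_parity_trans[OF fin, of c r i j] od' that by auto
    have r: "r < 4" using row_labels_less[OF L] by simp
    show ?thesis
    proof (cases "\<exists>s\<in>T. \<forall>j<4. c s j = c s 0")
      case True
      then obtain s where s: "s \<in> T" "\<forall>j<4. c s j = c s 0" by blast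
      have eq: "c s r = c s x" "c s x = c s y" "c s y = c s z"
        using s(2) unfolding all_rows_labels[OF L] by auto
      have "odd (disagreement (T - {s}) c r x)" "odd (disagreement (T - {s}) c r y)"
        "odd (disagreement (T - {s}) c r z)"
        using od eq unfolding disagreement_remove[OF fin s(1)] by auto
      note odd_row_column_better[OF fin s(1) L this eq(2,3)]
      then show ?thesis by blast
    next
      case noconst: False
      then have types: "lone (c s) \<or> balanced (c s)" if "s \<in> T" for s
        using that by (auto simp: balanced_def)
      have single: "\<forall>s\<in>T - {u}. balanced (c s)" if "?k = 1" "u \<in> T" "lone (c u)" for u
      proof
        fix s assume s: "s \<in> T - {u}"
        obtain w where w: "{t \<in> T. lone (c t)} = {w}" using \<open>?k = 1\<close> by (auto simp: card_1_singleton_iff)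
        then have "u = w" using that by blast
        then have "\<not> lone (c s)" using w s by blast
        then show "balanced (c s)" using types s by blast
      qed
      show ?thesis
      proof (cases "\<exists>u\<in>T. \<exists>i. isolates (c u) i \<and> i \<noteq> r")
        case True
        then obtain u i where u: "u \<in> T" "isolates (c u) i" "i \<noteq> r" by blast
        then have i: "i < 4" by (simp add: isolates_less)
        obtain p q where L': "row_labels i r p q" using row_labels_exist[OF i r u(3)] .
        have e: "even (disagreement T c i p)" "even (disagreement T c i q)" "odd (disagreement T c i r)"
          using ev' od' i u(3) row_labels_less[OF L'] row_labels_distinct[OF L'] disagreement_sym[of T c i r] by auto
        show ?thesis
        proof (cases "?k = 1")
          case True
          then show ?thesis
            using single_lone_column_better[OF fin card u(1,2) L' single e] u by (auto simp: lone_def)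
        next
          case False
          then have "?k > 1" using less.prems by simp
          then show ?thesis using pair[OF u(1,2) row_labels_swap(2)[OF L'] e(1)] by blast
        qed
      next
        case all_r: False
        then have tr: "isolates (c t) r" using t by (auto simp: lone_def)
        show ?thesis
        proof (cases "?k = 1")
          case True
          have "card T > 1" using card by simp
          then show ?thesis using True single_isolating_column_better[OF fin _ t(1) tr L single od(1,2)] t by blast
        next
          case False
          moreover have "?k \<noteq> 2" using \<open>odd ?k\<close> by auto
          ultimately have k: "?k > 1" "?k \<ge> 3" using less.prems by linarith+
          have "\<forall>t\<in>T. isolates (c t) r \<or> balanced (c t)" using types all_r by (auto simp: lone_def)
          then obtain c' where "weakly_better T c' c" "?k = Suc (card {t \<in> T. lone (c' t)})"
            using isolated[OF r k(2) \<open>odd ?k\<close>] ev' by blast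
          then show ?thesis using descend k(1) by blast
        qed
      qed
    qed
  qed
qed

section \<open>Codes as matrices\<close>

abbreviation columns :: "bool mat \<Rightarrow> nat \<Rightarrow> nat \<Rightarrow> bool" where
  "columns C \<equiv> \<lambda>t j. C $$ (j, t)"

abbreviation code_of :: "nat \<Rightarrow> (nat \<Rightarrow> nat \<Rightarrow> bool) \<Rightarrow> bool mat" where
  "code_of n c \<equiv> mat 4 n (\<lambda>(j, t). c t j)"

lemma weight_sum_cong:
  assumes "\<And>t j. t \<in> T \<Longrightarrow> j < 4 \<Longrightarrow> c t j = c' t j"
  shows "weight_sum T c q = weight_sum T c' q"
  unfolding weight_sum_def using min_dist_cong[of T c c'] assms by (intro sum.cong) auto

lemma lone_cong: "(\<And>j. j < 4 \<Longrightarrow> b j = b' j) \<Longrightarrow> lone b \<longleftrightarrow> lone b'"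
  unfolding lone_def isolates_def by (metis (no_types, lifting))

text \<open>
No distance exceeds \<open>n\<close>, so \<open>(1 - \<epsilon>)^n\<close> can be taken out of every term.
\<close>

lemma success_prob_weight_sum:
  assumes C: "C \<in> codes n" and \<epsilon>: "0 < \<epsilon>" "\<epsilon> < 1"
  shows "success_prob C \<epsilon> = (1 - \<epsilon>) ^ n / 4 * weight_sum {..<n} (columns C) (\<epsilon> / (1 - \<epsilon>))"
proof -
  let ?word = "\<lambda>y :: bool vec. {t. t < n \<and> y $ t}"
  have n: "dim_col C = n" "dim_row C = 4" using C by auto
  have dist: "hamming_dist (row C j) y = row_dist {..<n} (columns C) (?word y) j" if "j < 4" for j y
    unfolding hamming_dist_def row_dist_def using that n by (intro arg_cong[where f = card]) auto
  have "{0..3} = {..<4::nat}" by auto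
  then have code_dist: "code_dist C y = min_dist {..<n} (columns C) (?word y)" for y
    unfolding code_dist_def min_dist_def using dist by (intro arg_cong[where f = Min]) auto
  have le: "min_dist {..<n} (columns C) Y \<le> n" for Y
  proof -
    have "row_dist {..<n} (columns C) Y 0 \<le> card {..<n}"
      unfolding row_dist_def by (rule card_mono) auto
    then show ?thesis using min_dist_le[of 0 "{..<n}" "columns C" Y] by simp
  qed
  have "(1 - \<epsilon>) ^ (n - d) * \<epsilon> ^ d = (1 - \<epsilon>) ^ n * (\<epsilon> / (1 - \<epsilon>)) ^ d" if "d \<le> n" for d
    using \<epsilon> that by (simp add: power_divide power_diff field_simps)
  then have "(\<Sum>y\<in>carrier_vec n. (1 - \<epsilon>) ^ (n - code_dist C y) * \<epsilon> ^ code_dist C y)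
      = (\<Sum>y\<in>carrier_vec n. (1 - \<epsilon>) ^ n * (\<epsilon> / (1 - \<epsilon>)) ^ min_dist {..<n} (columns C) (?word y))"
    by (simp add: code_dist le)
  also have "\<dots> = (\<Sum>Y\<in>Pow {..<n}. (1 - \<epsilon>) ^ n * (\<epsilon> / (1 - \<epsilon>)) ^ min_dist {..<n} (columns C) Y)"
    by (rule sum.reindex_bij_witness[of _ "\<lambda>Y. vec n (\<lambda>t. t \<in> Y)" ?word]) auto
  finally show ?thesis
    unfolding success_prob_def n weight_sum_def by (simp add: sum_distrib_left)
qed

text \<open>
The map \<open>\<epsilon> \<mapsto> \<epsilon> / (1 - \<epsilon>)\<close> takes the interval from 0 to 1/2 onto the one from 0 to 1, so statements for
all \<open>\<epsilon>\<close> and for all \<open>q\<close> are interchangeable.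
\<close>

lemma odds_transform:
  assumes "0 < q" "q < (1::real)"
  obtains \<epsilon> where "0 < \<epsilon>" "\<epsilon> < 1 / 2" "q = \<epsilon> / (1 - \<epsilon>)"
proof (rule that[of "q / (1 + q)"])
  have "1 - q / (1 + q) = 1 / (1 + q)" using assms by (simp add: field_simps)
  then show "q = q / (1 + q) / (1 - q / (1 + q))" using assms by simp
qed (use assms in \<open>auto simp: field_simps\<close>)

lemma success_prob_le_iff:
  assumes C: "C \<in> codes n" "D \<in> codes n" and \<epsilon>: "0 < \<epsilon>" "\<epsilon> < 1 / 2"
  shows "success_prob C \<epsilon> \<le> success_prob D \<epsilon> \<longleftrightarrow>
    weight_sum {..<n} (columns C) (\<epsilon> / (1 - \<epsilon>)) \<le> weight_sum {..<n} (columns D) (\<epsilon> / (1 - \<epsilon>))"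
proof -
  have "0 < (1 - \<epsilon>) ^ n / 4" using \<epsilon> by simp
  then show ?thesis using C \<epsilon> by (simp add: success_prob_weight_sum del: times_divide_eq_left)
qed

lemma weakly_better_success_prob:
  assumes "C \<in> codes n" "D \<in> codes n"
    and "\<And>\<epsilon>. 0 < \<epsilon> \<Longrightarrow> \<epsilon> < 1 / 2 \<Longrightarrow> success_prob C \<epsilon> \<le> success_prob D \<epsilon>"
  shows "weakly_better {..<n} (columns D) (columns C)"
  unfolding weakly_better_def
proof safe
  fix q :: real assume "0 < q" "q < 1"
  then obtain \<epsilon> where "0 < \<epsilon>" "\<epsilon> < 1 / 2" "q = \<epsilon> / (1 - \<epsilon>)" by (rule odds_transform)
  then show "weight_sum {..<n} (columns C) q \<le> weight_sum {..<n} (columns D) q"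
    using assms success_prob_le_iff by blast
qed

lemma better_success_prob:
  assumes C: "C \<in> codes n" and "better {..<n} c (columns C)"
  shows "\<exists>D\<in>codes n. \<forall>\<epsilon>. 0 < \<epsilon> \<and> \<epsilon> < 1 / 2 \<longrightarrow> success_prob C \<epsilon> < success_prob D \<epsilon>"
proof (intro bexI[of _ "code_of n c"] allI impI)
  fix \<epsilon> :: real assume \<epsilon>: "0 < \<epsilon> \<and> \<epsilon> < 1 / 2"
  have "weight_sum {..<n} c q = weight_sum {..<n} (columns (code_of n c)) q" for q
    by (rule weight_sum_cong) simp
  moreover have "0 < \<epsilon> / (1 - \<epsilon>)" "\<epsilon> / (1 - \<epsilon>) < 1" using \<epsilon> by (simp_all add: field_simps)
  ultimately have "\<not> weight_sum {..<n} (columns (code_of n c)) (\<epsilon> / (1 - \<epsilon>)) \<le> weight_sum {..<n} (columns C) (\<epsilon> / (1 - \<epsilon>))"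
    using assms(2) unfolding better_def by (simp add: not_le)
  moreover have "code_of n c \<in> codes n" by simp
  ultimately show "success_prob C \<epsilon> < success_prob (code_of n c) \<epsilon>"
    using success_prob_le_iff[of "code_of n c" n C \<epsilon>] C \<epsilon> by (metis not_le)
qed simp

lemma weight_sum_permute_flip:
  assumes "\<pi> permutes {..<4::nat}"
  shows "weight_sum T (\<lambda>t j. c t (\<pi> j) \<noteq> c t r) q = weight_sum T c q"
proof -
  have "min_dist T (\<lambda>t j. c t (\<pi> j) \<noteq> c t r) X = min_dist T c (word_at T c r X)" for X
  proof -
    have "row_dist T (\<lambda>t j. c t (\<pi> j) \<noteq> c t r) X j = row_dist T c (word_at T c r X) (\<pi> j)" for j
      unfolding row_dist_def word_at_def by (intro arg_cong[where f = card]) auto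
    then have "row_dist T (\<lambda>t j. c t (\<pi> j) \<noteq> c t r) X ` {..<4}
        = row_dist T c (word_at T c r X) ` (\<pi> ` {..<4})"
      by (simp add: image_image)
    then show ?thesis unfolding min_dist_def permutes_image[OF assms] by simp
  qed
  then show ?thesis unfolding weight_sum_def by (subst (2) sum_Pow_word_at[of _ T c r]) simp
qed

lemma row_labels_0123: "row_labels 0 1 2 3"
  unfolding row_labels_def by auto

lemma col_type_0: "\<not> C $$ (0, t) \<Longrightarrow> col_type C t =
    4 * of_bool (C $$ (1, t)) + 2 * of_bool (C $$ (2, t)) + of_bool (C $$ (3, t))"
  by (simp add: col_type_def)

text \<open>
Complementing the columns that begin with 1 gives an equivalent code with types in \<open>{0, 3, 5, 6}\<close>. As it is
not linear, at most one of the types 3, 5, 6 occurs; these are the three pairings.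
\<close>

lemma two_row_code_of_not_linear:
  assumes C: "C \<in> codes n" and nonlin: "\<nexists>L. linear_code n L \<and> equivalent_codes n C L"
    and no_lone: "\<forall>t<n. \<not> lone (columns C t)"
  obtains i l p q where "row_labels i l p q" 
    "\<forall>t<n. C $$ (i, t) = C $$ (l, t) \<and> C $$ (p, t) = C $$ (q, t)"
proof -
  define L where "L = code_of n (\<lambda>t j. C $$ (j, t) \<noteq> C $$ (0, t))"
  have L: "L \<in> codes n" by (simp add: L_def)
  have entry: "L $$ (j, t) \<longleftrightarrow> C $$ (j, t) \<noteq> C $$ (0, t)" if "j < 4" "t < n" for j t
    using that by (simp add: L_def)
  have "equivalent_codes n C L"
    unfolding equivalent_codes_def
    by (intro conjI C L exI[of _ id] exI[of _ "{t. t < n \<and> C $$ (0, t)}"])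
       (auto simp: permutes_id entry)
  then have "\<not> linear_code n L" using nonlin by blast
  have lone: "\<not> (C $$ (0, t) \<noteq> C $$ (1, t)) \<noteq> (C $$ (2, t) \<noteq> C $$ (3, t))" if "t < n" for t
    using no_lone that lone_iff[OF row_labels_0123, of "columns C t"] by simp
  have types: "col_type L t \<in> {0, 3, 5, 6}"
    "col_type L t = 3 \<longleftrightarrow> C $$ (0, t) = C $$ (1, t) \<and> C $$ (0, t) \<noteq> C $$ (2, t)"
    "col_type L t = 5 \<longleftrightarrow> C $$ (0, t) = C $$ (2, t) \<and> C $$ (0, t) \<noteq> C $$ (1, t)"
    "col_type L t = 6 \<longleftrightarrow> C $$ (0, t) \<noteq> C $$ (1, t) \<and> C $$ (0, t) \<noteq> C $$ (2, t)" if "t < n" for t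
    using lone[OF that] that by (auto simp: col_type_0 entry of_bool_def)
  have "card {s \<in> {3, 5, 6}. type_count L s > 0} < 2"
    using \<open>\<not> linear_code n L\<close> L types(1) unfolding linear_code_def not_le[symmetric] by blast
  then have pair: "type_count L a = 0 \<or> type_count L b = 0" if "a \<in> {3, 5, 6}" "b \<in> {3, 5, 6}" "a \<noteq> b" for a b
  proof (rule contrapos_pp)
    assume "\<not> (type_count L a = 0 \<or> type_count L b = 0)"
    then have "card {a, b} \<le> card {s \<in> {3, 5, 6}. type_count L s > 0}"
      using that by (intro card_mono) auto
    then show "\<not> card {s \<in> {3, 5, 6}. type_count L s > 0} < 2" using that by simp
  qed
  have none: "\<forall>t<n. col_type L t \<noteq> s" if "type_count L s = 0" for s
    using that L by (auto simp: type_count_def)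
  consider "type_count L 5 = 0" "type_count L 6 = 0" | "type_count L 3 = 0" "type_count L 6 = 0"
    | "type_count L 3 = 0" "type_count L 5 = 0"
    using pair[of 3 5] pair[of 3 6] pair[of 5 6] by auto
  then show ?thesis
  proof cases
    case 1
    then have "\<forall>t<n. C $$ (0, t) = C $$ (1, t) \<and> C $$ (2, t) = C $$ (3, t)"
      using none[of 5] none[of 6] types(3,4) lone by blast
    then show ?thesis by (rule that[OF row_labels_0123])
  next
    case 2
    then have "\<forall>t<n. C $$ (0, t) = C $$ (2, t) \<and> C $$ (1, t) = C $$ (3, t)"
      using none[of 3] none[of 6] types(2,4) lone by blast
    then show ?thesis by (rule that[OF row_labels_swap(2)[OF row_labels_0123]])
  next
    case 3
    then have "\<forall>t<n. C $$ (0, t) = C $$ (3, t) \<and> C $$ (1, t) = C $$ (2, t)"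
      using none[of 3] none[of 5] types(2,3) lone by blast
    then show ?thesis
      by (rule that[OF row_labels_swap(2)[OF row_labels_swap(3)[OF row_labels_0123]]])
  qed
qed

lemma class_I_column_types:
  assumes t: "t < dim_col C" and zero: "\<not> C $$ (0, t)" and iso: "isolates (columns C t) 3 \<or> balanced (columns C t)"
  shows "col_type C t \<in> {1, 3, 5, 6}" 
    "col_type C t = 1 \<longleftrightarrow> lone (columns C t)"
    "col_type C t \<in> {5, 6} \<longleftrightarrow> C $$ (0, t) \<noteq> C $$ (1, t)"
    "col_type C t \<in> {3, 6} \<longleftrightarrow> C $$ (0, t) \<noteq> C $$ (2, t)"
  using zero iso
  unfolding balanced_def all_rows_labels[OF row_labels_0123] isolates_all_labels(4)[OF row_labels_0123] lone_iff[OF row_labels_0123]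
  by (auto simp: col_type_0 of_bool_def)

lemma min_type_mem: "min_type C \<in> {3, 5, 6}"
  unfolding min_type_def by (auto simp: Let_def)

lemma column_not_lone: "s \<in> {3, 5, 6} \<Longrightarrow> \<not> lone (\<lambda>j. bit (s :: nat) (3 - j))"
  unfolding lone_iff[OF row_labels_0123] by (auto simp: bit_iff_odd)

text \<open>
Exchanging row \<open>r\<close> with row 3 and complementing the columns whose first bit is then 1 turns the code into a
Class-I code with the same weight sum: the lone columns get type 1, and the three pairings get the types
3, 5, 6, whose counts have equal parity because the rows other than \<open>r\<close> have even distances.
\<close>

lemma class_I_replacement:
  assumes hyp: "\<forall>C. class_I n C \<and> type_count C 1 \<ge> 3 \<longrightarrow>
           (\<forall>t<n. col_type C t = 1 \<longrightarrow>
             (\<forall>\<epsilon>::real. 0 < \<epsilon> \<and> \<epsilon> < 1 / 2 \<longrightarrow>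
               success_prob (replace_col C t (min_type C)) \<epsilon> \<ge> success_prob C \<epsilon>))"
    and r: "r < 4" and three: "3 \<le> card {t \<in> {..<n}. lone (c t)}" and odd: "odd (card {t \<in> {..<n}. lone (c t)})"
    and cols: "\<forall>t\<in>{..<n}. isolates (c t) r \<or> balanced (c t)"
    and even: "\<forall>i<4. \<forall>j<4. i \<noteq> r \<longrightarrow> j \<noteq> r \<longrightarrow> even (disagreement {..<n} c i j)"
  shows "\<exists>c'. weakly_better {..<n} c' c \<and> card {t \<in> {..<n}. lone (c t)} = Suc (card {t \<in> {..<n}. lone (c' t)})"
proof -
  define \<pi> where "\<pi> = transpose r 3"
  have perm: "\<pi> permutes {..<4}" unfolding \<pi>_def using r by (intro permutes_swap_id) auto
  have \<pi>3: "\<pi> 3 = r" by (simp add: \<pi>_def)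
  have L: "row_labels (\<pi> 0) (\<pi> 1) (\<pi> 2) (\<pi> 3)"
  proof -
    have "{\<pi> 0, \<pi> 1, \<pi> 2, \<pi> 3} = \<pi> ` {0, 1, 2, 3}" by simp
    also have "{0, 1, 2, 3} = {..<4::nat}" by auto
    finally show ?thesis
      using permutes_image[OF perm] permutes_inj[OF perm] by (auto simp: row_labels_def inj_eq)
  qed
  define d where "d t j \<longleftrightarrow> c t (\<pi> j) \<noteq> c t (\<pi> 0)" for t j
  define C where "C = code_of n d"
  have C: "C \<in> codes n" "dim_col C = n" by (simp_all add: C_def)
  have entry: "C $$ (j, t) \<longleftrightarrow> c t (\<pi> j) \<noteq> c t (\<pi> 0)" if "j < 4" "t < n" for j t
    using that by (simp add: C_def d_def)
  have lone: "lone (columns C t) \<longleftrightarrow> lone (c t)" if "t < n" for t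
    unfolding lone_iff[OF row_labels_0123, of "columns C t"] lone_iff[OF L, of "c t"] using that by (auto simp: entry)
  have "isolates (columns C t) 3 \<or> balanced (columns C t)" if "t < n" for t
  proof -
    have "isolates (c t) r \<or> balanced (c t)" using cols that by simp
    then show ?thesis
      unfolding balanced_iff[OF row_labels_0123, of "columns C t"] balanced_iff[OF L, of "c t"]
        isolates_all_labels(4)[OF row_labels_0123, of "columns C t"]
        isolates_all_labels(4)[OF L, of "c t", unfolded \<pi>3] pairs_def
      using that by (auto simp: entry \<pi>3)
  qed
  then have types: "col_type C t \<in> {1, 3, 5, 6}" "col_type C t = 1 \<longleftrightarrow> lone (c t)"
    "col_type C t \<in> {5, 6} \<longleftrightarrow> c t (\<pi> 0) \<noteq> c t (\<pi> 1)"
    "col_type C t \<in> {3, 6} \<longleftrightarrow> c t (\<pi> 0) \<noteq> c t (\<pi> 2)" if "t < n" for t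
    using class_I_column_types[of t C] that C(2) lone[OF that] by (auto simp: entry)
  define S where "S s = {t. t < n \<and> col_type C t = s}" for s
  have S: "type_count C s = card (S s)" "finite (S s)" for s
    unfolding type_count_def S_def C(2) by simp_all
  have S_disj: "S a \<inter> S b = {}" if "a \<noteq> b" for a b using that by (auto simp: S_def)
  have "{..<n} = S 1 \<union> S 3 \<union> S 5 \<union> S 6" using types(1) by (auto simp: S_def)
  then have "card {..<n} = card (S 1 \<union> S 3 \<union> S 5 \<union> S 6)" by simp
  then have sum: "type_count C 1 + type_count C 3 + type_count C 5 + type_count C 6 = n"
    using S_disj S(2) by (simp add: S(1) card_Un_disjoint Int_Un_distrib2)
  have count1: "type_count C 1 = card {t \<in> {..<n}. lone (c t)}"
    unfolding S(1) S_def using types(2) by (intro arg_cong[where f = card]) auto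
  have "disagreement {..<n} c (\<pi> 0) (\<pi> 1) = card (S 5 \<union> S 6)"
    unfolding disagreement_def S_def using types(3) by (intro arg_cong[where f = card]) auto
  also have "\<dots> = type_count C 5 + type_count C 6"
    using S_disj S(2) by (simp add: S(1) card_Un_disjoint)
  finally have "even (type_count C 5 + type_count C 6)"
    using even row_labels_less[OF L] row_labels_distinct[OF L] \<pi>3 by metis
  moreover have "disagreement {..<n} c (\<pi> 0) (\<pi> 2) = card (S 3 \<union> S 6)"
    unfolding disagreement_def S_def using types(4) by (intro arg_cong[where f = card]) auto
  then have "disagreement {..<n} c (\<pi> 0) (\<pi> 2) = type_count C 3 + type_count C 6"
    using S_disj S(2) by (simp add: S(1) card_Un_disjoint)
  then have "even (type_count C 3 + type_count C 6)"
    using even row_labels_less[OF L] row_labels_distinct[OF L] \<pi>3 by metis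
  ultimately have "class_I n C"
    unfolding class_I_def using C(1) sum odd count1 by auto
  have "{t \<in> {..<n}. lone (c t)} \<noteq> {}" using three by (metis card.empty not_numeral_le_zero)
  then obtain t where t: "t < n" "lone (c t)" by auto
  let ?D = "replace_col C t (min_type C)"
  have D: "?D \<in> codes n" unfolding replace_col_def C(2) by simp
  have "success_prob C \<epsilon> \<le> success_prob ?D \<epsilon>" if "0 < \<epsilon>" "\<epsilon> < 1 / 2" for \<epsilon>
    using hyp \<open>class_I n C\<close> three count1 t types(2) that by auto
  then have "weakly_better {..<n} (columns ?D) (columns C)"
    by (rule weakly_better_success_prob[OF C(1) D])
  moreover have "weight_sum {..<n} (columns C) q = weight_sum {..<n} c q" for q
  proof -
    have "weight_sum {..<n} (columns C) q = weight_sum {..<n} (\<lambda>t j. c t (\<pi> j) \<noteq> c t (\<pi> 0)) q"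
      by (rule weight_sum_cong) (simp add: entry)
    then show ?thesis by (simp only: weight_sum_permute_flip[OF perm])
  qed
  ultimately have "weakly_better {..<n} (columns ?D) c" by (simp add: weakly_better_def)
  moreover have "card {u \<in> {..<n}. lone (c u)} = Suc (card {u \<in> {..<n}. lone (columns ?D u)})"
  proof -
    let ?b = "\<lambda>j. bit (min_type C) (3 - j)"
    have "lone (columns ?D u) \<longleftrightarrow> lone ((c(t := ?b)) u)" if "u < n" for u
    proof (cases "u = t")
      case True
      then show ?thesis using that by (intro lone_cong) (simp add: replace_col_def C(2))
    next
      case False
      then have "lone (columns ?D u) \<longleftrightarrow> lone (columns C u)"
        using that by (intro lone_cong) (simp add: replace_col_def C(2))
      then show ?thesis using lone[OF that] False by simp
    qed
    then have "{u \<in> {..<n}. lone (columns ?D u)} = {u \<in> {..<n}. lone ((c(t := ?b)) u)}" by blast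
    then show ?thesis
      using card_lone_replace[of "{..<n}" t c ?b] t column_not_lone[OF min_type_mem] by simp
  qed
  ultimately show ?thesis by blast
qed

theorem theorem4:
  fixes n :: nat
  assumes "n > 3"
    and "\<forall>C. class_I n C \<and> type_count C 1 \<ge> 3 \<longrightarrow>
           (\<forall>t<n. col_type C t = 1 \<longrightarrow>
             (\<forall>\<epsilon>::real. 0 < \<epsilon> \<and> \<epsilon> < 1 / 2 \<longrightarrow>
               success_prob (replace_col C t (min_type C)) \<epsilon> \<ge> success_prob C \<epsilon>))"
  shows "\<forall>C\<in>codes n. (\<nexists>L. linear_code n L \<and> equivalent_codes n C L) \<longrightarrow>
           (\<exists>D\<in>codes n. \<forall>\<epsilon>::real. 0 < \<epsilon> \<and> \<epsilon> < 1 / 2 \<longrightarrow>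
             success_prob D \<epsilon> > success_prob C \<epsilon>)"
proof (intro ballI impI)
  fix C assume C: "C \<in> codes n" and nonlin: "\<nexists>L. linear_code n L \<and> equivalent_codes n C L"
  have "\<exists>c. better {..<n} c (columns C)"
  proof (cases "card {t \<in> {..<n}. lone (columns C t)} > 0")
    case True
    show ?thesis
      by (rule lone_code_better[OF _ _ class_I_replacement[OF assms(2)] True]) (use assms(1) in auto)
  next
    case False
    then have "\<forall>t<n. \<not> lone (columns C t)" by auto
    then obtain i l p q where L: "row_labels i l p q"
      and eq: "\<forall>t<n. C $$ (i, t) = C $$ (l, t) \<and> C $$ (p, t) = C $$ (q, t)"
      by (rule two_row_code_of_not_linear[OF C nonlin])
    then show ?thesis using assms(1) by (intro two_row_code_better[OF _ L]) auto
  qed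
  then show "\<exists>D\<in>codes n. \<forall>\<epsilon>::real. 0 < \<epsilon> \<and> \<epsilon> < 1 / 2 \<longrightarrow> success_prob D \<epsilon> > success_prob C \<epsilon>"
    using better_success_prob[OF C] by blast
qed

end
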